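(* Let $0<\alpha<1$, let $h=t/n$ with $n$ a positive integer, and write $y_k=y(kh)$. Let $y(0)=y'(0)=y''(0)=0$. Then $$\frac{1}{\Gamma(1-\alpha)h^\alpha}\sum_{k=0}^{n}\omega_k^{(\alpha)} y_{n-k}= y_n^{(\alpha)}+\frac{1}{\Gamma(1-\alpha)}\left(2^\alpha-1\right)\zeta(\alpha)\,y'_n\, h^{1-\alpha}-\frac{2^{\alpha-1}-1}{\Gamma(1-\alpha)}\zeta(\alpha-1)\,y''_n\, h^{2-\alpha}+\frac{1}{24}\frac{d^2}{dt^2}y_n^{(\alpha)}\, h^2$$ $$+\frac{1}{\Gamma(1-\alpha)}\left(\frac{1}{24}\left(2^\alpha-1\right)\zeta(\alpha)+\frac{1}{2}\left(2^{\alpha-2}-1\right)\zeta(\alpha-2)\right)y'''_n\, h^{3-\alpha}+O\left(h^{4-\alpha}\right).$$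
   Context: $\zeta$ is the Riemann zeta function. The Caputo derivative of order $\alpha\in(0,1)$ is $y^{(\alpha)}(t)=\frac{1}{\Gamma(1-\alpha)}\int_0^t \frac{y'(x)}{(t-x)^\alpha}\,dx$. Since $t=nh$, $y_n^{(\alpha)}=y^{(\alpha)}(t)$, $y'_n=y'(t)$, $y''_n=y''(t)$, $y'''_n=y'''(t)$, and $\frac{d^2}{dt^2}y^{(\alpha)}_n$ is the second ordinary derivative of the function $y^{(\alpha)}$ at $t$. The weights are $$\omega_0^{(\alpha)}=2^\alpha,\qquad \omega_k^{(\alpha)}=2^\alpha\left(\frac{1}{(2k+1)^\alpha}-\frac{1}{(2k-1)^\alpha}\right)\ (k=1,\dots,n-1),\qquad \omega_n^{(\alpha)}=-\frac{2^\alpha}{(2n-1)^\alpha}.$$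
   Formalization: The smoothness of y left tacit here is made explicit: y is five times continuously differentiable on [0,T] for some T>t (without such smoothness the expansion fails, e.g. y(x)=x^{5/2}, α=0.3); O(h^{4-α}) is for fixed t and y as n→∞. *)

theory Defs
  imports "HOL-Complex_Analysis.Complex_Analysis"
begin

text \<open>
  The Riemann zeta function: the analytic continuation of the Dirichlet series
  \<open>1 + 2\<^sup>-\<^sup>s + 3\<^sup>-\<^sup>s + \<dots>\<close> to the complex plane without \<open>1\<close>. By the identity theorem the
  conditions determine \<open>zeta s\<close> for every \<open>s \<noteq> 1\<close>; the value at \<open>1\<close> is unspecified.
\<close>
definition zeta :: "complex \<Rightarrow> complex" where
  "zeta = (SOME f. f holomorphic_on (- {1}) \<and>
             (\<forall>s. Re s > 1 \<longrightarrow> (\<lambda>n. 1 / of_nat (Suc n) powr s) sums f s))"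

text \<open>The zeta function is real on the real axis, so taking the real part loses nothing.\<close>
definition zeta_real :: "real \<Rightarrow> real" where
  "zeta_real x = Re (zeta (complex_of_real x))"

text \<open>
  Iterated derivative relative to a set \<open>S\<close>: one-sided at the end points of an interval,
  the ordinary derivative at its interior points.
\<close>
fun nderiv :: "nat \<Rightarrow> real set \<Rightarrow> (real \<Rightarrow> real) \<Rightarrow> real \<Rightarrow> real" where
  "nderiv 0 S f = f"
| "nderiv (Suc k) S f = (\<lambda>x. vector_derivative (nderiv k S f) (at x within S))"

definition C_diff_on :: "nat \<Rightarrow> real set \<Rightarrow> (real \<Rightarrow> real) \<Rightarrow> bool" where
  "C_diff_on k S f \<longleftrightarrow>
     (\<forall>j<k. nderiv j S f differentiable_on S) \<and> continuous_on S (nderiv k S f)"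

text \<open>
  The integrand has an integrable singularity at \<open>x = t\<close>; \<open>integral\<close> is the gauge integral,
  which does not depend on the values of the integrand at the two end points.
\<close>
definition caputo :: "real \<Rightarrow> (real \<Rightarrow> real) \<Rightarrow> real \<Rightarrow> real" where
  "caputo \<alpha> y t =
     1 / Gamma (1 - \<alpha>) * integral {0..t} (\<lambda>x. deriv y x / (t - x) powr \<alpha>)"

text \<open>\<open>weight \<alpha> n k\<close> is meant for \<open>0 < n\<close> and \<open>k \<le> n\<close>.\<close>
definition weight :: "real \<Rightarrow> nat \<Rightarrow> nat \<Rightarrow> real" where
  "weight \<alpha> n k =
     (if k = 0 then 2 powr \<alpha>
      else if k < n then
        2 powr \<alpha> * (1 / (2 * real k + 1) powr \<alpha> - 1 / (2 * real k - 1) powr \<alpha>)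
      else - (2 powr \<alpha> / (2 * real n - 1) powr \<alpha>))"

end

theory Submission
  imports Defs
begin

text \<open>
  Put \<open>v u = y t - y (t - u)\<close>. Summation by parts turns the weighted sum into
  \<open>\<Sum>k<n. (v ((k + 1) h) - v (k h)) ((k + 1/2) h)\<^sup>-\<^sup>\<alpha>\<close>, a midpoint-type sum for
  \<open>\<integral> v' u\<^sup>-\<^sup>\<alpha>\<close>. Split \<open>v\<close> into its cubic Taylor polynomial at \<open>0\<close> and a rest \<open>W = O(u\<^sup>4)\<close>.

  The polynomial part reduces to the sums \<open>\<Sum>k<n. (k + 1/2)\<^sup>-\<^sup>\<sigma>\<close> with \<open>\<sigma> = \<alpha>, \<alpha> - 1, \<alpha> - 2\<close>, whose
  constant term is \<open>(2\<^sup>\<sigma> - 1) \<zeta>(\<sigma>)\<close> by analytic continuation from \<open>\<sigma> > 1\<close>. For \<open>W\<close> the singularity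
  is harmless: on each cell the midpoint error is of fifth order with constant \<open>u\<^sup>-\<^sup>1\<^sup>-\<^sup>\<alpha>\<close>, which sums to
  \<open>O(h\<^sup>4\<^sup>-\<^sup>\<alpha>)\<close>, while the terms of order \<open>h\<^sup>2\<close> sum to a boundary term and the integral of
  \<open>W''' u\<^sup>-\<^sup>\<alpha>\<close>. The boundary terms at \<open>u = t\<close> of both parts cancel because
  \<open>y' 0 = y'' 0 = 0\<close>, and the same two conditions identify \<open>\<integral> v''' u\<^sup>-\<^sup>\<alpha>\<close> with the second derivative of
  the Caputo derivative.
\<close>

section \<open>Analytic continuation of the zeta function\<close>

text \<open>The weights are increments of (k + 1/2)^(-\<alpha>), so every difference of v is centred
  exactly at the node where the kernel is evaluated. Expansions about that node keep odd orders
  only, and each 1/24 stems from the third-order midpoint term h^3/24.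

  The \<zeta>-terms are the trace of the singularity at u = 0: the power u^j in v' produces a sum of
  (k + 1/2)^(j-\<alpha>), whose constant term survives the scaling as h^(1+j-\<alpha>). The
  coefficient of y''' has two parts because the cubic term of v yields both the quadratic term of v'
  and a constant third difference, and the latter meets the sum for j = 0 again. The minus sign at
  y'' comes from v'' = -y''(t - u).

  The split is made at degree three because the h^5 errors then add up to h^(4-\<alpha>) times a
  partial sum of k^(-1-\<alpha>), a series that converges exactly when \<alpha> > 0.

  As \<open>zeta\<close> is a choice among functions with two properties, no fact about it is
  available until one such function has been built; hence the explicit continuation at the
  start.\<close>

lemma norm_gbinomial_le:
  fixes a :: complex
  assumes "norm a \<le> M"
  shows "norm (a gchoose n) \<le> pochhammer M n / fact n"
proof -
  \<comment> \<open>Bounding factor by factor leaves a dependence on \<open>a\<close> through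
    \<open>M\<close> only; the later remainder estimates owe their uniformity to this.\<close>
  have "norm (pochhammer (- a) n) \<le> pochhammer M n"
    unfolding pochhammer_prod prod_norm [symmetric]
  proof (rule prod_mono)
    fix i
    have "norm (- a + of_nat i) \<le> norm a + real i"
      using norm_triangle_ineq [of "- a" "of_nat i"] by simp
    then show "0 \<le> norm (- a + of_nat i) \<and> norm (- a + of_nat i) \<le> M + real i"
      using assms by auto
  qed
  then show ?thesis
    by (simp add: gbinomial_pochhammer norm_mult norm_divide norm_power divide_right_mono)
qed

text \<open>For |x| \<le> y/2 the tail of the binomial series from index \<open>N\<close> on is
  dominated by a geometric-type series that does not involve \<open>a\<close>, \<open>x\<close> or
  \<open>y\<close>. The single constant \<open>C\<close> for all |a| \<le> M is the point: it gives
  convergence of series of such remainders uniformly in the exponent.\<close>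

lemma binomial_remainder_bound:
  fixes M :: real
  obtains C where "C \<ge> 0"
    and "\<And>a x y. norm (a::complex) \<le> M \<Longrightarrow> 0 < y \<Longrightarrow> \<bar>x\<bar> \<le> y / 2 \<Longrightarrow>
      norm (of_real (x + y) powr a
        - (\<Sum>n<N. (a gchoose n) * of_real x ^ n * of_real y powr (a - of_nat n)))
      \<le> C * \<bar>x\<bar> ^ N * y powr (Re a - real N)"
proof (cases "M \<ge> 0")
  case False
  show ?thesis
  proof (rule that [of 0])
    fix a :: complex assume "norm a \<le> M"
    with False have False using norm_ge_zero [of a] by linarith
    then show "norm (of_real (x + y) powr a
        - (\<Sum>n<N. (a gchoose n) * of_real x ^ n * of_real y powr (a - of_nat n)))
      \<le> 0 * \<bar>x\<bar> ^ N * y powr (Re a - real N)" for x y ..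
  qed simp
next
  case True
  define b where "b n = pochhammer M n / fact n" for n
  have b0: "b n \<ge> 0" for n
    using True by (auto simp: b_def pochhammer_prod intro!: prod_nonneg divide_nonneg_nonneg)
  \<comment> \<open>The \<open>b n\<close> are the Taylor coefficients of (1 - z)^(-M), and z = 1/2
    lies inside the unit disc.\<close>
  have "summable (\<lambda>n. b n * (1/2) ^ n)"
  proof -
    have "(\<lambda>n. ((- M) gchoose n) * (- (1/2)) ^ n) sums (1 + - (1/2)) powr (- M)"
      by (rule gen_binomial_real) simp
    moreover have "((- M) gchoose n) * (- (1/2)) ^ n = b n * (1/2) ^ n" for n
    proof -
      have "(-1::real) ^ n * (- (1/2)) ^ n = (1/2) ^ n"
        by (simp flip: power_mult_distrib)
      then show ?thesis by (simp add: b_def gbinomial_pochhammer field_simps)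
    qed
    ultimately show ?thesis by (simp add: sums_iff)
  qed
  then have "summable (\<lambda>n. b (n + N) * (1/2) ^ (n + N))"
    by (rule summable_ignore_initial_segment)
  then have "summable (\<lambda>n. 2 ^ N * (b (n + N) * (1/2) ^ (n + N)))"
    by (rule summable_mult)
  then have sb: "summable (\<lambda>n. b (n + N) * (1/2) ^ n)"
    by (simp add: power_add field_simps)
  define C where "C = (\<Sum>n. b (n + N) * (1/2) ^ n)"
  show ?thesis
  proof (rule that [of C])
    show "C \<ge> 0" unfolding C_def using sb b0 by (intro suminf_nonneg) auto
    fix a :: complex and x y :: real
    assume a: "norm a \<le> M" and y: "0 < y" and x: "\<bar>x\<bar> \<le> y / 2"
    let ?f = "\<lambda>n. (a gchoose n) * of_real x ^ n * of_real y powr (a - of_nat n)"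
    let ?k = "\<bar>x\<bar> ^ N * y powr (Re a - real N)"
    have "?f sums of_real (x + y) powr a"
      using x y by (intro gen_binomial_complex') auto
    then have s: "(\<lambda>n. ?f (n + N)) sums (of_real (x + y) powr a - (\<Sum>n<N. ?f n))"
      by (rule iffD2 [OF sums_iff_shift'])
    have bd: "norm (?f (n + N)) \<le> (b (n + N) * (1/2) ^ n) * ?k" for n
    proof -
      have "norm (of_real y powr (a - of_nat (n + N))) = y powr (Re a - real N - real n)"
        using y by (subst norm_powr_real_powr) (auto simp: algebra_simps)
      also have "\<dots> = y powr (Re a - real N) * (1 / y ^ n)"
        using y by (simp add: powr_diff powr_realpow)
      finally have "norm (of_real y powr (a - of_nat (n + N))) = y powr (Re a - real N) * (1 / y ^ n)" .
      then have "norm (?f (n + N))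
          = norm (a gchoose (n + N)) * (\<bar>x\<bar> / y) ^ n * ?k"
        by (simp add: norm_mult norm_power power_add power_divide)
      also have "\<dots> \<le> b (n + N) * (1/2) ^ n * ?k"
        using a x y b0 norm_gbinomial_le [OF a]
        by (intro mult_right_mono mult_mono power_mono) (auto simp: b_def field_simps)
      finally show ?thesis .
    qed
    have sk: "summable (\<lambda>n. (b (n + N) * (1/2) ^ n) * ?k)"
      using sb by (rule summable_mult2)
    have sn: "summable (\<lambda>n. norm (?f (n + N)))"
      by (rule summable_comparison_test' [OF sk]) (use bd in auto)
    have "norm (\<Sum>n. ?f (n + N)) \<le> (\<Sum>n. norm (?f (n + N)))"
      by (rule summable_norm [OF sn])
    also have "\<dots> \<le> (\<Sum>n. (b (n + N) * (1/2) ^ n) * ?k)"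
      by (rule suminf_le [OF bd sn sk])
    also have "\<dots> = C * ?k"
      unfolding C_def by (rule suminf_mult2 [OF sb, symmetric])
    finally show "norm (of_real (x + y) powr a - (\<Sum>n<N. ?f n)) \<le> C * \<bar>x\<bar> ^ N * y powr (Re a - real N)"
      using s by (simp add: sums_iff mult.assoc)
  qed
qed

text \<open>The constant depends only on a bound for \<open>norm s\<close>, so the convergence is locally uniform.\<close>
lemma holomorphic_powr_bounded_series:
  fixes f :: "nat \<Rightarrow> complex \<Rightarrow> complex"
  assumes hol: "\<And>n. f n holomorphic_on {s. Re s > c}"
    and bd: "\<And>M. \<exists>C\<ge>0. \<forall>s n. norm s \<le> M \<longrightarrow> n \<ge> 2 \<longrightarrow> norm (f n s) \<le> C * real n powr (c - Re s - 1)"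
  shows "(\<lambda>s. \<Sum>n. f n s) holomorphic_on {s. Re s > c}" 
    and "\<And>s. Re s > c \<Longrightarrow> summable (\<lambda>n. f n s)"
proof -
  have op: "open {s. Re s > c}" by (rule open_halfspace_Re_gt)
  have ev: "\<exists>d h. 0 < d \<and> summable h \<and> range h \<subseteq> \<real>\<^sub>\<ge>\<^sub>0 \<and>
      (\<forall>\<^sub>F n in sequentially. \<forall>s\<in>ball s0 d \<inter> {s. Re s > c}. cmod (f n s) \<le> cmod (h n))"
    if "s0 \<in> {s. Re s > c}" for s0
  proof -
    \<comment> \<open>Half the distance from \<open>s0\<close> to the boundary line: on the ball of
      this radius Re s > c + d, so n^(-1-d) is a common summable majorant.\<close>
    define d where "d = (Re s0 - c) / 2"
    have d: "d > 0" using that by (simp add: d_def)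
    obtain C where C: "C \<ge> 0" "\<And>s n. norm s \<le> norm s0 + d \<Longrightarrow> n \<ge> 2 \<Longrightarrow>
        norm (f n s) \<le> C * real n powr (c - Re s - 1)"
      using bd by blast
    define h :: "nat \<Rightarrow> real" where "h n = C * real n powr (- 1 - d)" for n
    have h: "summable h" unfolding h_def
      by (intro summable_mult) (use d in \<open>simp add: summable_real_powr_iff\<close>)
    have h0: "h n \<ge> 0" for n using C by (simp add: h_def)
    have "\<forall>\<^sub>F n in sequentially. \<forall>s\<in>ball s0 d \<inter> {s. Re s > c}. cmod (f n s) \<le> cmod (of_real (h n))"
      using eventually_ge_at_top [of 2]
    proof eventually_elim
      case (elim n)
      show ?case
      proof
        fix s assume "s \<in> ball s0 d \<inter> {s. Re s > c}"
        then have s: "norm (s0 - s) < d" by (simp add: dist_norm)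
        have "norm s \<le> norm s0 + d" using s norm_triangle_ineq3 [of s0 s] by linarith
        moreover have "Re s > c + d"
          using s abs_Re_le_cmod [of "s0 - s"] by (simp add: d_def field_simps abs_if split: if_splits)
        ultimately have 1: "norm (f n s) \<le> C * real n powr (c - Re s - 1)" and 2: "c - Re s - 1 \<le> - 1 - d"
          using C(2) [OF _ elim] by simp_all
        have "real n powr (c - Re s - 1) \<le> real n powr (- 1 - d)"
          using 2 elim by (intro powr_mono) auto
        then have "norm (f n s) \<le> h n"
          using 1 C(1) mult_left_mono unfolding h_def by (metis order.trans)
        then show "cmod (f n s) \<le> cmod (of_real (h n))" using h0 by simp
      qed
    qed
    moreover have "summable (\<lambda>n. complex_of_real (h n))" using h by (simp add: summable_of_real)
    moreover have "range (\<lambda>n. complex_of_real (h n)) \<subseteq> \<real>\<^sub>\<ge>\<^sub>0" using h0 by auto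
    ultimately show ?thesis using d by blast
  qed
  have fd: "f n field_differentiable (at s)" if "s \<in> {s. Re s > c}" for n s
    by (rule holomorphic_on_imp_differentiable_at [OF hol op that])
  obtain g where g: "\<forall>s \<in> {s. Re s > c}. ((\<lambda>n. f n s) sums g s) \<and> g field_differentiable (at s)"
    by (rule series_differentiable_comparison_complex [OF op fd ev])
  then show "\<And>s. Re s > c \<Longrightarrow> summable (\<lambda>n. f n s)"
    by (auto simp: sums_iff)
  have "g holomorphic_on {s. Re s > c}"
    using g by (auto simp: holomorphic_on_def field_differentiable_at_within)
  then show "(\<lambda>s. \<Sum>n. f n s) holomorphic_on {s. Re s > c}"
    by (rule holomorphic_transform) (use g in \<open>auto simp: sums_iff\<close>)
qed

section \<open>The Dirichlet series and its continuation to an entire function after removal of the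
  pole\<close>

definition zeta_series :: "complex \<Rightarrow> complex" where
  "zeta_series s = (\<Sum>n. of_nat n powr (- s))"

lemma
  shows holomorphic_zeta_series: "zeta_series holomorphic_on {s. Re s > 1}"
    and zeta_series_sums: "\<And>s. Re s > 1 \<Longrightarrow> (\<lambda>n. of_nat n powr (- s)) sums zeta_series s"
proof -
  have hol: "(\<lambda>s. of_nat n powr (- s)) holomorphic_on {s. Re s > 1}" for n
    by (intro holomorphic_intros)
  have bd: "\<exists>C\<ge>0. \<forall>s n. norm s \<le> M \<longrightarrow> n \<ge> 2 \<longrightarrow>
      norm (of_nat n powr (- s) :: complex) \<le> C * real n powr (1 - Re s - 1)" for M
    by (intro exI [of _ 1]) (auto simp: norm_powr_real_powr)
  show "zeta_series holomorphic_on {s. Re s > 1}"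
    using holomorphic_powr_bounded_series(1) [OF hol bd] unfolding zeta_series_def .
  show "(\<lambda>n. of_nat n powr (- s)) sums zeta_series s" if "Re s > 1" for s
    using holomorphic_powr_bounded_series(2) [OF hol bd that] unfolding zeta_series_def by (rule summable_sums)
qed

lemma gbinomial_Suc_right:
  fixes a :: "'a :: field_char_0"
  shows "a gchoose Suc k = (a gchoose k) * (a - of_nat k) / of_nat (Suc k)"
  by (simp add: gbinomial_prod_rev prod.atLeast0_lessThan_Suc)

text \<open>Summing the binomial expansion of \<open>(n + 1)\<^sup>1\<^sup>-\<^sup>s - n\<^sup>1\<^sup>-\<^sup>s\<close> over \<open>n\<close> expresses \<open>(s - 1) \<zeta>(s)\<close> through
  \<open>\<zeta>(s + 1), \<dots>, \<zeta>(s + K)\<close> and a remainder that converges in the half-plane \<open>Re s > - K\<close>.\<close>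
lemma zeta_continuation_step:
  assumes hol: "\<Phi> holomorphic_on {s. Re s > 1 - real K}"
    and eq: "\<And>s. Re s > 1 \<Longrightarrow> \<Phi> s = (s - 1) * zeta_series s"
  obtains \<Phi>' where "\<Phi>' holomorphic_on {s. Re s > - real K}"
    and "\<And>s. Re s > 1 \<Longrightarrow> \<Phi>' s = (s - 1) * zeta_series s"
proof -
  \<comment> \<open>Subtracting \<open>K + 2\<close> terms leaves order n^(-s-K-1), summable for Re
    s > -K. The term k = 0 telescopes against the leading power, k = 1 is (1 - s) n^(-s), and the
    others lead to the shifted arguments.\<close>
  define r where "r n s = of_nat (n + 1) powr (1 - s)
      - (\<Sum>k<K+2. ((1 - s) gchoose k) * of_nat n powr (1 - s - of_nat k))" for n and s :: complex
  have r_hol: "r n holomorphic_on {s. Re s > - real K}" for n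
    unfolding r_def gbinomial_prod_rev by (intro holomorphic_intros) auto
  have r_bd: "\<exists>C\<ge>0. \<forall>s n. norm s \<le> M \<longrightarrow> n \<ge> 2 \<longrightarrow> norm (r n s) \<le> C * real n powr (- real K - Re s - 1)" for M
  proof -
    obtain C where C: "C \<ge> 0" "\<And>a x y. norm (a::complex) \<le> 1 + M \<Longrightarrow> 0 < y \<Longrightarrow> \<bar>x\<bar> \<le> y / 2 \<Longrightarrow>
      norm (of_real (x + y) powr a
        - (\<Sum>n<K+2. (a gchoose n) * of_real x ^ n * of_real y powr (a - of_nat n)))
      \<le> C * \<bar>x\<bar> ^ (K+2) * y powr (Re a - real (K+2))"
      by (rule binomial_remainder_bound [where M = "1 + M" and N = "K + 2"]) blast
    show ?thesis
    proof (intro exI [of _ C] conjI allI impI)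
      fix s :: complex and n :: nat
      assume "norm s \<le> M" "2 \<le> n"
      then have "norm (1 - s) \<le> 1 + M"
        using norm_triangle_ineq4 [of 1 s] by simp
      from C(2) [OF this, of "real n" 1] \<open>2 \<le> n\<close>
      have "norm (r n s) \<le> C * real n powr (Re (1 - s) - real (K + 2))"
        by (simp add: r_def del: sum.lessThan_Suc)
      also have "Re (1 - s) - real (K + 2) = - real K - Re s - 1" by simp
      finally show "norm (r n s) \<le> C * real n powr (- real K - Re s - 1)" .
    qed (rule C)
  qed
  \<comment> \<open>The coefficient \<open>(1 - s) gchoose (i + 2)\<close> contains the factor -(s +
    i), which is exactly what turns \<zeta>(s + i + 1) into \<Phi>(s + i + 1). The poles of the
    shifted zeta values thus disappear without any division by s + i.\<close>
  define \<Phi>' where "\<Phi>' s = (\<Sum>n. r n s)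
      + (\<Sum>i<K. - ((1 - s) gchoose Suc i) / of_nat (i + 2) * \<Phi> (s + of_nat i + 1))" for s
  show ?thesis
  proof (rule that)
    have "(\<lambda>s. \<Phi> (s + of_nat i + 1)) holomorphic_on {s. Re s > - real K}" for i
      by (rule holomorphic_on_compose_gen [OF _ hol, unfolded o_def])
        (auto intro!: holomorphic_intros)
    then show "\<Phi>' holomorphic_on {s. Re s > - real K}"
      unfolding \<Phi>'_def gbinomial_prod_rev
      by (intro holomorphic_intros holomorphic_powr_bounded_series(1) [OF r_hol r_bd]) auto
  next
    fix s :: complex
    assume s: "Re s > 1"
    have tel: "(\<lambda>n. of_nat (Suc n) powr (1 - s) - of_nat n powr (1 - s)) sums (0 - of_nat 0 powr (1 - s))"
    proof (rule telescope_sums)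
      have "(\<lambda>n. real n powr Re (1 - s)) \<longlonglongrightarrow> 0"
        using s by (intro tendsto_neg_powr filterlim_real_sequentially) auto
      then show "(\<lambda>n. of_nat n powr (1 - s) :: complex) \<longlonglongrightarrow> 0"
        by (subst tendsto_norm_zero_iff [symmetric]) (simp add: norm_powr_real_powr)
    qed
    have "(\<lambda>n. ((1 - s) gchoose Suc j) * of_nat n powr (- (s + of_nat j)))
        sums (((1 - s) gchoose Suc j) * zeta_series (s + of_nat j))" for j
      by (intro sums_mult zeta_series_sums) (use s in auto)
    then have "(\<lambda>n. \<Sum>j<K+1. ((1 - s) gchoose Suc j) * of_nat n powr (- (s + of_nat j)))
        sums (\<Sum>j<K+1. ((1 - s) gchoose Suc j) * zeta_series (s + of_nat j))"
      by (rule sums_sum)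
    from sums_diff [OF tel this]
    have "(\<lambda>n. r n s) sums - (\<Sum>j<K+1. ((1 - s) gchoose Suc j) * zeta_series (s + of_nat j))"
      by (simp add: r_def sum.lessThan_Suc_shift [of _ "Suc K"] algebra_simps del: sum.lessThan_Suc)
    then have "(\<Sum>n. r n s) = - (\<Sum>j<K+1. ((1 - s) gchoose Suc j) * zeta_series (s + of_nat j))"
      by (simp add: sums_iff)
    also have "\<dots> = (s - 1) * zeta_series s
        - (\<Sum>i<K. ((1 - s) gchoose Suc (Suc i)) * zeta_series (s + of_nat i + 1))"
      by (simp add: sum.lessThan_Suc_shift algebra_simps del: sum.lessThan_Suc)
    finally have *: "(\<Sum>n. r n s) = \<dots>" .
    have "- ((1 - s) gchoose Suc i) / of_nat (i + 2) * \<Phi> (s + of_nat i + 1)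
        = ((1 - s) gchoose Suc (Suc i)) * zeta_series (s + of_nat i + 1)" for i
    proof -
      have "1 - s - of_nat (Suc i) = - (s + of_nat i)" by simp
      moreover have "\<Phi> (s + of_nat i + 1) = (s + of_nat i) * zeta_series (s + of_nat i + 1)"
        using s by (subst eq) auto
      ultimately show ?thesis
        by (simp only: gbinomial_Suc_right [of _ "Suc i"] times_divide_eq_left minus_divide_left
            mult_minus_right mult_minus_left mult.assoc add_2_eq_Suc')
    qed
    then show "\<Phi>' s = (s - 1) * zeta_series s"
      by (simp add: \<Phi>'_def *)
  qed
qed

text \<open>The half-planes Re s > 1 - K exhaust the plane, and by the identity theorem the
  continuations on them agree wherever two are defined, so they glue. The factor s - 1 makes the
  result entire.\<close>

lemma zeta_continuation:
  obtains \<Phi> where "\<Phi> holomorphic_on UNIV" and "\<And>s. Re s > 1 \<Longrightarrow> \<Phi> s = (s - 1) * zeta_series s"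
proof -
  have "\<exists>\<Phi>. \<Phi> holomorphic_on {s. Re s > 1 - real K} \<and> (\<forall>s. Re s > 1 \<longrightarrow> \<Phi> s = (s - 1) * zeta_series s)" for K
  proof (induction K)
    case 0
    show ?case
      by (intro exI [of _ "\<lambda>s. (s - 1) * zeta_series s"])
        (auto intro!: holomorphic_intros holomorphic_zeta_series)
  next
    case (Suc K)
    then show ?case by (auto elim!: zeta_continuation_step)
  qed
  then obtain \<Phi> where hol: "\<And>K. \<Phi> K holomorphic_on {s. Re s > 1 - real K}"
    and eq: "\<And>K s. Re s > 1 \<Longrightarrow> \<Phi> K s = (s - 1) * zeta_series s"
    by metis
  have agree: "\<Phi> K s = \<Phi> L s" if "K \<le> L" "Re s > 1 - real K" for K L s
  proof (rule analytic_continuation_open [where s = "{s. Re s > 1}" and s' = "{s. Re s > 1 - real K}"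
        and f = "\<Phi> K" and g = "\<Phi> L"])
    show "{s. 1 < Re s} \<noteq> {}" by (auto intro: exI [of _ 2])
    show "\<Phi> L holomorphic_on {s. Re s > 1 - real K}"
      by (rule holomorphic_on_subset [OF hol]) (use that in auto)
  qed (use that hol eq in \<open>auto intro: open_halfspace_Re_gt convex_connected convex_halfspace_Re_gt\<close>)
  \<comment> \<open>Any index whose half-plane contains \<open>s\<close> would do; the summand 2
    secures the strict inequality.\<close>
  define k where "k s = nat \<lceil>\<bar>Re s\<bar>\<rceil> + 2" for s
  define \<Psi> where "\<Psi> s = \<Phi> (k s) s" for s
  have k: "Re s > 1 - real (k s)" for s unfolding k_def by linarith
  have \<Psi>: "\<Psi> s = \<Phi> K s" if "Re s > 1 - real K" for s K
    using agree [of K "k s" s] agree [of "k s" K s] k [of s] that unfolding \<Psi>_def by (metis nle_le)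
  show ?thesis
  proof (rule that [of \<Psi>])
    show "\<Psi> s = (s - 1) * zeta_series s" if "Re s > 1" for s
      using eq [OF that] by (simp add: \<Psi>_def)
    have "\<Psi> holomorphic_on {s. Re s > 1 - real K}" for K
      by (rule holomorphic_transform [OF hol [of K]]) (simp add: \<Psi>)
    then have "\<Psi> holomorphic_on (\<Union>K. {s. Re s > 1 - real K})"
      by (intro holomorphic_on_UN_open open_halfspace_Re_gt)
    moreover have "(\<Union>K. {s. Re s > 1 - real K}) = UNIV" using k by auto
    ultimately show "\<Psi> holomorphic_on UNIV" by simp
  qed
qed

text \<open>The entire function divided by s - 1 witnesses that the choice defining
  \<open>zeta\<close> is not vacuous. From there on only the two defining properties are used; for
  Re s > 1 the value follows from uniqueness of sums.\<close>

lemma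
  shows holomorphic_zeta: "zeta holomorphic_on - {1}"
    and zeta_eq_zeta_series: "\<And>s. Re s > 1 \<Longrightarrow> zeta s = zeta_series s"
proof -
  let ?P = "\<lambda>f. f holomorphic_on (- {1}) \<and>
             (\<forall>s. Re s > 1 \<longrightarrow> (\<lambda>n. 1 / of_nat (Suc n) powr s) sums f s)"
  have sums: "(\<lambda>n. 1 / of_nat (Suc n) powr s) sums zeta_series s" if "Re s > 1" for s :: complex
  proof -
    \<comment> \<open>The term of \<open>zeta_series\<close> at n = 0 vanishes because
      \<open>0 powr z = 0\<close>, so the shift of index costs nothing.\<close>
    have "(\<lambda>n. of_nat (Suc n) powr (- s)) sums zeta_series s"
      using zeta_series_sums [OF that] by (subst sums_Suc_iff) simp
    then show ?thesis by (simp add: powr_minus_divide)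
  qed
  obtain \<Phi> where \<Phi>: "\<Phi> holomorphic_on UNIV" "\<And>s. Re s > 1 \<Longrightarrow> \<Phi> s = (s - 1) * zeta_series s"
    by (rule zeta_continuation) auto
  have "?P (\<lambda>s. \<Phi> s / (s - 1))"
  proof (intro conjI allI impI)
    show "(\<lambda>s. \<Phi> s / (s - 1)) holomorphic_on - {1}"
      using holomorphic_on_subset [OF \<Phi>(1)] by (intro holomorphic_intros) auto
    fix s :: complex assume s: "Re s > 1"
    then have "s \<noteq> 1" by auto
    then show "(\<lambda>n. 1 / of_nat (Suc n) powr s) sums (\<Phi> s / (s - 1))"
      using sums [OF s] \<Phi>(2) [OF s] by simp
  qed
  then have P: "?P zeta" unfolding zeta_def by (rule someI [where P = ?P])
  then show "zeta holomorphic_on - {1}" by blast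
  show "zeta s = zeta_series s" if "Re s > 1" for s
    using P that sums [OF that] by (blast intro: sums_unique2)
qed

section \<open>Midpoint sums of powers\<close>

text \<open>Group the terms of the zeta series in pairs 2n, 2n + 1. The even ones sum to 2^(-s)
  \<zeta>(s), the odd ones to 2^(-s) times the series sought; solve and multiply by 2^s.\<close>

lemma odd_zeta_series:
  assumes "Re s > 1"
  shows "(\<lambda>k. (of_nat k + 1/2) powr (- s)) sums ((2 powr s - 1) * zeta s)"
proof -
  have z: "(\<lambda>n. of_nat n powr (- s)) sums zeta s"
    using zeta_series_sums [OF assms] zeta_eq_zeta_series [OF assms] by simp
  have "(\<lambda>n. \<Sum>i\<in>{n * 2..<n * 2 + 2}. of_nat i powr (- s)) sums zeta s"
    by (rule sums_group [OF z]) simp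
  moreover have "(\<Sum>i\<in>{n * 2..<n * 2 + 2}. of_nat i powr (- s) :: complex)
      = 2 powr (- s) * of_nat n powr (- s) + 2 powr (- s) * (of_nat n + 1/2) powr (- s)" for n
  proof -
    have "{n * 2..<n * 2 + 2} = {2 * n, 2 * n + 1}" by auto
    moreover have "(of_nat (2 * n) :: complex) powr (- s) = 2 powr (- s) * of_nat n powr (- s)"
      by (simp add: powr_times_real)
    moreover have "(of_nat (2 * n + 1) :: complex) = of_real 2 * of_real (real n + 1/2)"
      by simp
    then have "(of_nat (2 * n + 1) :: complex) powr (- s) = of_real 2 powr (- s) * of_real (real n + 1/2) powr (- s)"
      by (simp only: powr_times_real Reals_of_real Re_complex_of_real)
    ultimately show ?thesis by simp
  qed
  ultimately have "(\<lambda>n. 2 powr (- s) * of_nat n powr (- s) + 2 powr (- s) * (of_nat n + 1/2) powr (- s)) sums zeta s"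
    by simp
  from sums_diff [OF this sums_mult [OF z, of "2 powr (- s)"]]
  have "(\<lambda>n. 2 powr (- s) * (of_nat n + 1/2) powr (- s)) sums (zeta s - 2 powr (- s) * zeta s)"
    by simp
  from sums_mult [OF this, of "2 powr s"]
  have "(\<lambda>n. (2 powr s * 2 powr (- s)) * (of_nat n + 1/2) powr (- s))
      sums (2 powr s * zeta s - (2 powr s * 2 powr (- s)) * zeta s)"
    by (simp add: right_diff_distrib mult.assoc)
  moreover have "2 powr s * 2 powr (- s) = (1 :: complex)"
    by (simp flip: powr_add)
  ultimately show ?thesis by (simp add: left_diff_distrib)
qed

text \<open>\<open>1 - s\<close> times the error of the corrected midpoint rule for \<open>x\<^sup>-\<^sup>s\<close> on \<open>{k..k + 1}\<close>; the factor
  removes the pole at \<open>1\<close>. For \<open>k = 0\<close> the convention \<open>0 powr z = 0\<close> drops the boundary terms at \<open>0\<close>,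
  so that partial sums telescope.\<close>
definition midpoint_defect :: "nat \<Rightarrow> complex \<Rightarrow> complex" where
  "midpoint_defect k s = (1 - s) * (of_nat k + 1/2) powr (- s)
     - (of_nat (Suc k) powr (1 - s) - of_nat k powr (1 - s))
     - s * (1 - s) / 24 * (of_nat (Suc k) powr (- s - 1) - of_nat k powr (- s - 1))"

text \<open>About the midpoint m = k + 1/2 even orders cancel. The first order matches (1 - s)
  m^(-s), and the third, (1 - s) s (s + 1) / 24 times m^(-s-2), is removed by the leading part of
  the last correction, so order m^(-s-4) remains. The exponent is written in the shape required by
  \<open>holomorphic_powr_bounded_series\<close> with \<open>c = - 3\<close>.\<close>

lemma midpoint_defect_bound:
  "\<exists>C\<ge>0. \<forall>s k. norm s \<le> M \<longrightarrow> k \<ge> 2 \<longrightarrow> norm (midpoint_defect k s) \<le> C * real k powr (- 3 - Re s - 1)"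
proof (cases "M \<ge> 0")
  case False
  then have "\<not> norm s \<le> M" for s :: complex using norm_ge_zero [of s] by linarith
  then show ?thesis by (intro exI [of _ 0]) simp
next
  case True
  obtain C1 where C1: "C1 \<ge> 0" "\<And>a x y. norm (a::complex) \<le> 1 + M \<Longrightarrow> 0 < y \<Longrightarrow> \<bar>x\<bar> \<le> y / 2 \<Longrightarrow>
      norm (of_real (x + y) powr a
        - (\<Sum>n<5. (a gchoose n) * of_real x ^ n * of_real y powr (a - of_nat n)))
      \<le> C1 * \<bar>x\<bar> ^ 5 * y powr (Re a - real 5)"
    by (rule binomial_remainder_bound [where M = "1 + M" and N = 5]) blast
  obtain C2 where C2: "C2 \<ge> 0" "\<And>a x y. norm (a::complex) \<le> 1 + M \<Longrightarrow> 0 < y \<Longrightarrow> \<bar>x\<bar> \<le> y / 2 \<Longrightarrow>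
      norm (of_real (x + y) powr a
        - (\<Sum>n<3. (a gchoose n) * of_real x ^ n * of_real y powr (a - of_nat n)))
      \<le> C2 * \<bar>x\<bar> ^ 3 * y powr (Re a - real 3)"
    by (rule binomial_remainder_bound [where M = "1 + M" and N = 3]) blast
  \<comment> \<open>\<open>M * (1 + M)\<close> bounds the factor s (1 - s) / 24 of the second
    expansion; the power of 2 pays for passing from m back to k, as 1 \<le> m/k \<le> 2.\<close>
  define C where "C = (C1 + M * (1 + M) * C2) * 2 powr (M + 4)"
  show ?thesis
  proof (intro exI [of _ C] conjI allI impI)
    show "C \<ge> 0" using C1 C2 True by (simp add: C_def)
    fix s :: complex and k :: nat
    assume s: "norm s \<le> M" and k: "2 \<le> k"
    define m where "m = real k + 1/2"
    have m: "m > 0" "1/2 \<le> m / 2" using k by (auto simp: m_def)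
    define p where "p = m powr (- Re s - 4)"
    have s1: "norm (1 - s) \<le> 1 + M" and s2: "norm (- s - 1) \<le> 1 + M"
      using s norm_triangle_ineq4 [of 1 s] norm_triangle_ineq4 [of "- s" 1] by auto
    define e1 where "e1 x = of_real (x + m) powr (1 - s)
      - (\<Sum>n<5. ((1 - s) gchoose n) * of_real x ^ n * of_real m powr (1 - s - of_nat n))" for x
    define e2 where "e2 x = of_real (x + m) powr (- s - 1)
      - (\<Sum>n<3. ((- s - 1) gchoose n) * of_real x ^ n * of_real m powr (- s - 1 - of_nat n))" for x
    have e1: "norm (e1 x) \<le> C1 / 2 * p" if "\<bar>x\<bar> = 1/2" for x
    proof -
      have "norm (e1 x) \<le> C1 * (1/2) ^ 5 * p"
        using C1(2) [OF s1 m(1), of x] m that by (simp add: e1_def p_def algebra_simps)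
      also have "\<dots> \<le> C1 / 2 * p" using C1(1) by (intro mult_right_mono) (simp_all add: p_def eval_nat_numeral)
      finally show ?thesis .
    qed
    have e2: "norm (e2 x) \<le> C2 / 2 * p" if "\<bar>x\<bar> = 1/2" for x
    proof -
      have "norm (e2 x) \<le> C2 * (1/2) ^ 3 * p"
        using C2(2) [OF s2 m(1), of x] m that by (simp add: e2_def p_def algebra_simps)
      also have "\<dots> \<le> C2 / 2 * p" using C2(1) by (intro mult_right_mono) (simp_all add: p_def eval_nat_numeral)
      finally show ?thesis .
    qed
    have k1: "complex_of_real (1/2 + m) = of_nat (Suc k)" "complex_of_real (- (1/2) + m) = of_nat k"
      by (simp_all add: m_def)
    have d1: "of_nat (Suc k) powr (1 - s) - of_nat k powr (1 - s)
      = (1 - s) * of_real m powr (- s) + (1 - s) * s * (s + 1) / 24 * of_real m powr (- s - 2)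
        + (e1 (1/2) - e1 (- (1/2)))"
    proof -
      have sum5: "(\<Sum>n<5. (a gchoose n) * of_real x ^ n * w n) = w 0 + a * of_real x * w 1
          + (a gchoose 2) * of_real x ^ 2 * w 2 + a * (a - 1) * (a - 2) / 6 * of_real x ^ 3 * w 3
          + (a gchoose 4) * of_real x ^ 4 * w 4" for a :: complex and w :: "nat \<Rightarrow> complex" and x
      proof -
        have "(a gchoose 3) = a * (a - 1) * (a - 2) / 6"
          by (simp add: gbinomial_prod_rev eval_nat_numeral)
        then show ?thesis by (simp add: eval_nat_numeral)
      qed
      have w: "1 - s - of_nat 1 = - s" "1 - s - of_nat 3 = - s - 2" by simp_all
      show ?thesis
        unfolding e1_def k1 sum5 w by (simp add: field_simps eval_nat_numeral)
    qed
    have d2: "of_nat (Suc k) powr (- s - 1) - of_nat k powr (- s - 1)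
      = - (s + 1) * of_real m powr (- s - 2) + (e2 (1/2) - e2 (- (1/2)))"
    proof -
      have sum3: "(\<Sum>n<3. (a gchoose n) * of_real x ^ n * w n) = w 0 + a * of_real x * w 1
          + (a gchoose 2) * of_real x ^ 2 * w 2" for a :: complex and w :: "nat \<Rightarrow> complex" and x
        by (simp add: eval_nat_numeral)
      have w: "- s - 1 - of_nat 1 = - s - 2" by simp
      show ?thesis
        unfolding e2_def k1 sum3 w by (simp add: field_simps eval_nat_numeral)
    qed
    have "midpoint_defect k s = - (e1 (1/2) - e1 (- (1/2))) - s * (1 - s) / 24 * (e2 (1/2) - e2 (- (1/2)))"
      unfolding midpoint_defect_def d1 d2 by (simp add: m_def field_simps)
    also have "norm \<dots> \<le> norm (e1 (1/2) - e1 (- (1/2))) + norm (s * (1 - s) / 24 * (e2 (1/2) - e2 (- (1/2))))"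
      by (rule order.trans [OF norm_triangle_ineq4]) (simp only: norm_minus_cancel order.refl)
    also have "\<dots> \<le> C1 * p + M * (1 + M) * (C2 * p)"
    proof (rule add_mono)
      show "norm (e1 (1/2) - e1 (- (1/2))) \<le> C1 * p"
        using norm_triangle_ineq4 [of "e1 (1/2)" "e1 (- (1/2))"] e1 [of "1/2"] e1 [of "- (1/2)"] by simp
      have "norm (e2 (1/2) - e2 (- (1/2))) \<le> C2 * p"
        using norm_triangle_ineq4 [of "e2 (1/2)" "e2 (- (1/2))"] e2 [of "1/2"] e2 [of "- (1/2)"] by simp
      moreover have "norm (s * (1 - s) / 24) \<le> M * (1 + M)"
      proof -
        have "norm (s * (1 - s) / 24) \<le> norm s * norm (1 - s)" by (simp add: norm_mult norm_divide)
        also have "\<dots> \<le> M * (1 + M)" using s s1 True by (intro mult_mono) auto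
        finally show ?thesis .
      qed
      ultimately show "norm (s * (1 - s) / 24 * (e2 (1/2) - e2 (- (1/2)))) \<le> M * (1 + M) * (C2 * p)"
        unfolding norm_mult [of "s * (1 - s) / 24"] using True by (intro mult_mono) auto
    qed
    also have "\<dots> = (C1 + M * (1 + M) * C2) * p" by (simp add: algebra_simps)
    also have "\<dots> \<le> (C1 + M * (1 + M) * C2) * (2 powr (M + 4) * real k powr (- 3 - Re s - 1))"
    proof (rule mult_left_mono)
      have "p = (m / real k) powr (- Re s - 4) * real k powr (- Re s - 4)"
        using k m by (simp add: p_def powr_divide)
      moreover have "(m / real k) powr (- Re s - 4) \<le> 2 powr (M + 4)"
      proof -
        have "1 \<le> m / real k" "m / real k \<le> 2" using k by (auto simp: m_def field_simps)
        \<comment> \<open>The exponent may have either sign. Since the base is at least 1, it can be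
          raised to \<open>M + 4\<close>, which is positive and free of \<open>s\<close>.\<close>
        moreover have "- Re s - 4 \<le> M + 4" using s abs_Re_le_cmod [of s] by linarith
        ultimately have "(m / real k) powr (- Re s - 4) \<le> (m / real k) powr (M + 4)"
          by (intro powr_mono) auto
        also have "\<dots> \<le> 2 powr (M + 4)"
          using \<open>1 \<le> m / real k\<close> \<open>m / real k \<le> 2\<close> True by (intro powr_mono2) auto
        finally show ?thesis .
      qed
      moreover have "- 3 - Re s - 1 = - Re s - 4" by simp
      ultimately show "p \<le> 2 powr (M + 4) * real k powr (- 3 - Re s - 1)"
        by (metis mult_right_mono powr_ge_zero)
    qed (use C1 C2 True in simp)
    finally show "norm (midpoint_defect k s) \<le> C * real k powr (- 3 - Re s - 1)"
      by (simp add: C_def mult.assoc)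
  qed
qed

lemma sum_midpoint_defect:
  "(\<Sum>k<N. midpoint_defect k s) = (1 - s) * (\<Sum>k<N. (of_nat k + 1/2) powr (- s))
     - of_nat N powr (1 - s) - s * (1 - s) / 24 * of_nat N powr (- s - 1)"
  by (induction N) (simp_all add: midpoint_defect_def algebra_simps)

lemma holomorphic_midpoint_defect: "midpoint_defect k holomorphic_on A"
  unfolding midpoint_defect_def by (intro holomorphic_intros) auto

text \<open>The two sides agree for \<open>Re s > 1\<close>, where the correction terms of \<open>midpoint_defect\<close>
  telescope to zero.\<close>
lemma suminf_midpoint_defect:
  assumes "Re s > - 3" "s \<noteq> 1"
  shows "(\<Sum>k. midpoint_defect k s) = (1 - s) * (2 powr s - 1) * zeta s"
proof (rule analytic_continuation_open [where s = "{s. Re s > 1}" and s' = "{s. Re s > - 3} - {1}"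
      and f = "\<lambda>s. \<Sum>k. midpoint_defect k s" and g = "\<lambda>s. (1 - s) * (2 powr s - 1) * zeta s"])
  show "open {s. 1 < Re s}" by (rule open_halfspace_Re_gt)
  show "open ({s. - 3 < Re s} - {1})" by (intro open_Diff open_halfspace_Re_gt) auto
  show "{s. 1 < Re s} \<noteq> {}" by (auto intro: exI [of _ 2])
  show "connected ({s. - 3 < Re s} - {1})"
    by (intro connected_open_delete open_halfspace_Re_gt convex_connected convex_halfspace_Re_gt) simp
  show "{s. 1 < Re s} \<subseteq> {s. - 3 < Re s} - {1}" by auto
  show "s \<in> {s. - 3 < Re s} - {1}" using assms by simp
  show "(\<lambda>s. \<Sum>k. midpoint_defect k s) holomorphic_on {s. - 3 < Re s} - {1}"
    by (rule holomorphic_on_subset [OF holomorphic_powr_bounded_series(1)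
          [OF holomorphic_midpoint_defect midpoint_defect_bound]]) auto
  show "(\<lambda>s. (1 - s) * (2 powr s - 1) * zeta s) holomorphic_on {s. - 3 < Re s} - {1}"
    by (intro holomorphic_intros holomorphic_on_subset [OF holomorphic_zeta]) auto
  fix s :: complex assume "s \<in> {s. 1 < Re s}"
  then have s: "Re s > 1" by simp
  have lim: "(\<lambda>n. of_nat n powr w :: complex) \<longlonglongrightarrow> 0" if "Re w < 0" for w
  proof -
    have "(\<lambda>n. real n powr Re w) \<longlonglongrightarrow> 0"
      using that by (intro tendsto_neg_powr filterlim_real_sequentially) auto
    then show ?thesis
      by (subst tendsto_norm_zero_iff [symmetric]) (simp add: norm_powr_real_powr)
  qed
  have "(\<lambda>N. (1 - s) * (\<Sum>k<N. (of_nat k + 1/2) powr (- s)) - of_nat N powr (1 - s)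
          - s * (1 - s) / 24 * of_nat N powr (- s - 1))
        \<longlonglongrightarrow> (1 - s) * ((2 powr s - 1) * zeta s) - 0 - s * (1 - s) / 24 * 0"
    using odd_zeta_series [OF s] s unfolding sums_def
    by (intro tendsto_intros lim) auto
  then have "(\<lambda>k. midpoint_defect k s) sums ((1 - s) * ((2 powr s - 1) * zeta s))"
    unfolding sums_def sum_midpoint_defect by simp
  then show "(\<Sum>k. midpoint_defect k s) = (1 - s) * (2 powr s - 1) * zeta s"
    by (simp add: sums_iff mult.assoc)
qed

text \<open>Multiplied by 1 - \<sigma>, the difference is minus the tail from \<open>N\<close> of
  the defect series, whose terms are O(k^(-\<sigma>-4)). Writing k^(-\<sigma>-4) = k^(-q)
  k^(-\<sigma>-4+q) and bounding the first factor by N^(-q) leaves a convergent series precisely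
  because q < \<sigma> + 3.\<close>

lemma midpoint_power_sum:
  fixes \<sigma> q :: real
  assumes \<sigma>: "\<sigma> > - 3" "\<sigma> \<noteq> 1" and q: "0 \<le> q" "q < \<sigma> + 3"
  shows "(\<lambda>N. (\<Sum>k<N. (real k + 1/2) powr (- \<sigma>))
      - (real N powr (1 - \<sigma>) / (1 - \<sigma>) + (2 powr \<sigma> - 1) * zeta_real \<sigma> + \<sigma> / 24 * real N powr (- \<sigma> - 1)))
     \<in> O(\<lambda>N. real N powr (- q))"
proof -
  let ?s = "complex_of_real \<sigma>"
  obtain C where C: "C \<ge> 0" "\<And>k. k \<ge> 2 \<Longrightarrow> norm (midpoint_defect k ?s) \<le> C * real k powr (- \<sigma> - 4)"
  proof -
    obtain C where "C \<ge> 0" and C: "\<forall>s k. norm s \<le> norm ?s \<longrightarrow> k \<ge> 2 \<longrightarrow>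
        norm (midpoint_defect k s) \<le> C * real k powr (- 3 - Re s - 1)"
      using midpoint_defect_bound by blast
    moreover have "- 3 - Re ?s - 1 = - \<sigma> - 4" by simp
    ultimately show ?thesis using that by (metis order.refl)
  qed
  define A where "A = (\<Sum>k. real k powr (- \<sigma> - 4 + q))"
  have sA: "summable (\<lambda>k. real k powr (- \<sigma> - 4 + q))"
    using q by (simp add: summable_real_powr_iff)
  have "summable (\<lambda>k. midpoint_defect k ?s)"
    by (rule holomorphic_powr_bounded_series(2) [OF holomorphic_midpoint_defect midpoint_defect_bound])
      (use \<sigma> in simp)
  then have sm: "(\<lambda>k. midpoint_defect k ?s) sums ((1 - ?s) * (2 powr ?s - 1) * zeta ?s)"
    using suminf_midpoint_defect [of ?s] \<sigma> by (auto simp: sums_iff)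
  show ?thesis
  proof (rule bigoI [of _ "C * A / \<bar>1 - \<sigma>\<bar>"], rule eventually_mono [OF eventually_ge_at_top [of 2]])
    fix N :: nat assume N: "N \<ge> 2"
    define X where "X = (\<Sum>k<N. (real k + 1/2) powr (- \<sigma>))
      - (real N powr (1 - \<sigma>) / (1 - \<sigma>) + (2 powr \<sigma> - 1) * zeta_real \<sigma> + \<sigma> / 24 * real N powr (- \<sigma> - 1))"
    have P: "(\<Sum>k<N. midpoint_defect k ?s) = of_real ((1 - \<sigma>) * (\<Sum>k<N. (real k + 1/2) powr (- \<sigma>))
      - real N powr (1 - \<sigma>) - \<sigma> * (1 - \<sigma>) / 24 * real N powr (- \<sigma> - 1))"
    proof -
      have "(of_nat k + 1/2) powr (- ?s) = of_real ((real k + 1/2) powr (- \<sigma>))" for k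
        using powr_of_real [of "real k + 1/2" "- \<sigma>"] by simp
      moreover have "of_nat N powr (1 - ?s) = of_real (real N powr (1 - \<sigma>))"
        using powr_of_real [of "real N" "1 - \<sigma>"] by simp
      moreover have "of_nat N powr (- ?s - 1) = of_real (real N powr (- \<sigma> - 1))"
        using powr_of_real [of "real N" "- \<sigma> - 1"] by simp
      ultimately show ?thesis by (simp add: sum_midpoint_defect)
    qed
    \<comment> \<open>The factor in front of \<open>zeta ?s\<close> is real, so real parts give
      \<open>zeta_real\<close> directly; that zeta is real at this point does not have to be
      proved.\<close>
    have Z: "Re ((1 - ?s) * (2 powr ?s - 1) * zeta ?s) = (1 - \<sigma>) * (2 powr \<sigma> - 1) * zeta_real \<sigma>"
    proof -
      have "(1 - ?s) * (2 powr ?s - 1) = of_real ((1 - \<sigma>) * (2 powr \<sigma> - 1))"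
        using powr_of_real [of 2 \<sigma>] by simp
      then show ?thesis
        by (simp only: zeta_real_def times_complex.sel Re_complex_of_real Im_complex_of_real)
    qed
    have sums: "(\<lambda>k. midpoint_defect (k + N) ?s) sums
        ((1 - ?s) * (2 powr ?s - 1) * zeta ?s - (\<Sum>k<N. midpoint_defect k ?s))"
      by (rule iffD2 [OF sums_iff_shift' sm])
    have "(1 - \<sigma>) * X = - Re ((1 - ?s) * (2 powr ?s - 1) * zeta ?s - (\<Sum>k<N. midpoint_defect k ?s))"
      using \<sigma> unfolding minus_complex.sel Z P by (simp add: X_def field_simps)
    then have X: "\<bar>1 - \<sigma>\<bar> * \<bar>X\<bar> \<le> norm (\<Sum>k. midpoint_defect (k + N) ?s)"
      using sums abs_Re_le_cmod [of "\<Sum>k. midpoint_defect (k + N) ?s"]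
      by (simp add: sums_iff flip: abs_mult)
    have bd: "norm (midpoint_defect (k + N) ?s) \<le> C * real N powr (- q) * real (k + N) powr (- \<sigma> - 4 + q)" for k
    proof -
      have "norm (midpoint_defect (k + N) ?s) \<le> C * real (k + N) powr (- q + (- \<sigma> - 4 + q))"
        using C(2) [of "k + N"] N by simp
      also have "\<dots> = C * real (k + N) powr (- q) * real (k + N) powr (- \<sigma> - 4 + q)"
        by (subst powr_add) simp
      also have "\<dots> \<le> C * real N powr (- q) * real (k + N) powr (- \<sigma> - 4 + q)"
        using N q C(1) by (intro mult_right_mono mult_left_mono powr_mono2') auto
      finally show ?thesis .
    qed
    have s2: "summable (\<lambda>k. C * real N powr (- q) * real (k + N) powr (- \<sigma> - 4 + q))"
      by (intro summable_mult summable_ignore_initial_segment sA)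
    have s3: "summable (\<lambda>k. norm (midpoint_defect (k + N) ?s))"
      by (rule summable_comparison_test' [OF s2]) (use bd in auto)
    note X
    also have "norm (\<Sum>k. midpoint_defect (k + N) ?s) \<le> (\<Sum>k. norm (midpoint_defect (k + N) ?s))"
      by (rule summable_norm [OF s3])
    also have "\<dots> \<le> (\<Sum>k. C * real N powr (- q) * real (k + N) powr (- \<sigma> - 4 + q))"
      by (rule suminf_le [OF bd s3 s2])
    also have "\<dots> = C * real N powr (- q) * (\<Sum>k. real (k + N) powr (- \<sigma> - 4 + q))"
      by (intro suminf_mult summable_ignore_initial_segment sA)
    also have "\<dots> \<le> C * real N powr (- q) * A"
      unfolding A_def using C(1) suminf_split_initial_segment [OF sA, of N]
      by (intro mult_left_mono) (auto intro!: sum_nonneg)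
    finally have "\<bar>X\<bar> \<le> C * A / \<bar>1 - \<sigma>\<bar> * real N powr (- q)"
      using \<sigma> by (simp add: field_simps)
    then show "norm ((\<Sum>k<N. (real k + 1/2) powr (- \<sigma>))
      - (real N powr (1 - \<sigma>) / (1 - \<sigma>) + (2 powr \<sigma> - 1) * zeta_real \<sigma> + \<sigma> / 24 * real N powr (- \<sigma> - 1)))
      \<le> C * A / \<bar>1 - \<sigma>\<bar> * norm (real N powr (- q))"
      by (simp add: X_def)
  qed
qed

section \<open>The midpoint rule with a power kernel\<close>

text \<open>Taylor's formula of order 4 at the midpoint, with half step r: even orders cancel
  between the two ends, and 2 r^3/6 = (2r)^3/24. \<open>G i\<close> plays the role of the i-th
  derivative; the constant is not meant to be sharp.\<close>

lemma midpoint_difference_order5: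
  fixes G :: "nat \<Rightarrow> real \<Rightarrow> real"
  assumes ab: "a \<le> b"
    and der: "\<And>i x. x \<in> {a..b} \<Longrightarrow> i \<le> 4 \<Longrightarrow> (G i has_real_derivative G (Suc i) x) (at x within {a..b})"
    and bd: "\<And>x. x \<in> {a..b} \<Longrightarrow> \<bar>G 5 x\<bar> \<le> B"
  shows "\<bar>G 0 b - G 0 a - (b - a) * G 1 ((a + b) / 2) - (b - a) ^ 3 / 24 * G 3 ((a + b) / 2)\<bar> \<le> B * (b - a) ^ 5"
proof -
  define m r where "m = (a + b) / 2" and "r = (b - a) / 2"
  have m: "m \<in> {a..b}" and r: "b - m = r" "a - m = - r" "r \<ge> 0" and r2: "2 * r = b - a"
    using ab by (auto simp: m_def r_def field_simps)
  have B: "B \<ge> 0" using bd [OF m] by linarith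
  have T: "\<bar>G 0 z - (\<Sum>i\<le>4. G i m * (z - m) ^ i / fact i)\<bar> \<le> B * \<bar>z - m\<bar> ^ 5 / 24" if "z \<in> {a..b}" for z
    using field_Taylor [of "{a..b}" 4 G B m z] der bd m that by (simp add: eval_nat_numeral)
  have s: "(\<Sum>i\<le>4. G i m * x ^ i / fact i) = G 0 m + G 1 m * x + G 2 m * x ^ 2 / 2 + G 3 m * x ^ 3 / 6 + G 4 m * x ^ 4 / 24" for x
    by (simp add: eval_nat_numeral)
  define e where "e z = G 0 z - (\<Sum>i\<le>4. G i m * (z - m) ^ i / fact i)" for z
  have "\<bar>e b\<bar> \<le> B * r ^ 5 / 24" "\<bar>e a\<bar> \<le> B * r ^ 5 / 24"
    using T [of b] T [of a] ab r unfolding e_def by auto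
  then have "\<bar>e b - e a\<bar> \<le> B * r ^ 5" by linarith
  also have "e b - e a = G 0 b - G 0 a - 2 * r * G 1 m - (2 * r) ^ 3 / 24 * G 3 m"
    unfolding e_def s r by (simp add: algebra_simps eval_nat_numeral)
  also have "B * r ^ 5 \<le> B * (2 * r) ^ 5"
    using r B by (intro mult_left_mono power_mono) auto
  finally show ?thesis unfolding r2 m_def .
qed

lemma midpoint_difference_order3:
  fixes G :: "nat \<Rightarrow> real \<Rightarrow> real"
  assumes ab: "a \<le> b"
    and der: "\<And>i x. x \<in> {a..b} \<Longrightarrow> i \<le> 2 \<Longrightarrow> (G i has_real_derivative G (Suc i) x) (at x within {a..b})"
    and bd: "\<And>x. x \<in> {a..b} \<Longrightarrow> \<bar>G 3 x\<bar> \<le> B"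
  shows "\<bar>G 0 b - G 0 a - (b - a) * G 1 ((a + b) / 2)\<bar> \<le> B * (b - a) ^ 3"
proof -
  define m r where "m = (a + b) / 2" and "r = (b - a) / 2"
  have m: "m \<in> {a..b}" and r: "b - m = r" "a - m = - r" "r \<ge> 0" and r2: "2 * r = b - a"
    using ab by (auto simp: m_def r_def field_simps)
  have B: "B \<ge> 0" using bd [OF m] by linarith
  have T: "\<bar>G 0 z - (\<Sum>i\<le>2. G i m * (z - m) ^ i / fact i)\<bar> \<le> B * \<bar>z - m\<bar> ^ 3 / 2" if "z \<in> {a..b}" for z
    using field_Taylor [of "{a..b}" 2 G B m z] der bd m that by (simp add: eval_nat_numeral)
  have s: "(\<Sum>i\<le>2. G i m * x ^ i / fact i) = G 0 m + G 1 m * x + G 2 m * x ^ 2 / 2" for x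
    by (simp add: eval_nat_numeral)
  define e where "e z = G 0 z - (\<Sum>i\<le>2. G i m * (z - m) ^ i / fact i)" for z
  have "\<bar>e b\<bar> \<le> B * r ^ 3 / 2" "\<bar>e a\<bar> \<le> B * r ^ 3 / 2"
    using T [of b] T [of a] ab r unfolding e_def by auto
  then have "\<bar>e b - e a\<bar> \<le> B * r ^ 3" by linarith
  also have "e b - e a = G 0 b - G 0 a - 2 * r * G 1 m"
    unfolding e_def s r by (simp add: algebra_simps eval_nat_numeral)
  also have "B * r ^ 3 \<le> B * (2 * r) ^ 3"
    using r B by (intro mult_left_mono power_mono) auto
  finally show ?thesis unfolding r2 m_def .
qed

lemma midpoint_rule_order5:
  fixes F :: "nat \<Rightarrow> real \<Rightarrow> real"
  assumes ab: "a \<le> b"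
    and der: "\<And>i x. x \<in> {a..b} \<Longrightarrow> i \<le> 3 \<Longrightarrow> (F i has_real_derivative F (Suc i) x) (at x within {a..b})"
    and bd: "\<And>x. x \<in> {a..b} \<Longrightarrow> \<bar>F 4 x\<bar> \<le> B"
  shows "\<bar>integral {a..b} (F 0) - (b - a) * F 0 ((a + b) / 2) - (b - a) ^ 3 / 24 * F 2 ((a + b) / 2)\<bar>
    \<le> B * (b - a) ^ 5"
proof -
  \<comment> \<open>Prepending an antiderivative to the family turns the quadrature rule into the
    difference formula one order higher.\<close>
  define G where "G i = (case i of 0 \<Rightarrow> \<lambda>x. integral {a..x} (F 0) | Suc j \<Rightarrow> F j)" for i
  have cont: "continuous_on {a..b} (F 0)"
    by (rule DERIV_continuous_on [of _ _ "F 1"]) (use der [of _ 0] in auto)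
  have "\<bar>G 0 b - G 0 a - (b - a) * G 1 ((a + b) / 2) - (b - a) ^ 3 / 24 * G 3 ((a + b) / 2)\<bar> \<le> B * (b - a) ^ 5"
  proof (rule midpoint_difference_order5 [OF ab])
    fix i x assume x: "x \<in> {a..b}" and i: "i \<le> (4::nat)"
    show "(G i has_real_derivative G (Suc i) x) (at x within {a..b})"
    proof (cases i)
      case 0
      then show ?thesis using integral_has_real_derivative [OF cont x] by (simp add: G_def)
    next
      case (Suc j)
      then show ?thesis using der [OF x, of j] i by (simp add: G_def)
    qed
  qed (use bd in \<open>simp add: G_def eval_nat_numeral\<close>)
  then show ?thesis by (simp add: G_def eval_nat_numeral)
qed

lemma midpoint_rule_order3:
  fixes F :: "nat \<Rightarrow> real \<Rightarrow> real"
  assumes ab: "a \<le> b"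
    and der: "\<And>i x. x \<in> {a..b} \<Longrightarrow> i \<le> 1 \<Longrightarrow> (F i has_real_derivative F (Suc i) x) (at x within {a..b})"
    and bd: "\<And>x. x \<in> {a..b} \<Longrightarrow> \<bar>F 2 x\<bar> \<le> B"
  shows "\<bar>integral {a..b} (F 0) - (b - a) * F 0 ((a + b) / 2)\<bar> \<le> B * (b - a) ^ 3"
proof -
  define G where "G i = (case i of 0 \<Rightarrow> \<lambda>x. integral {a..x} (F 0) | Suc j \<Rightarrow> F j)" for i
  have cont: "continuous_on {a..b} (F 0)"
    by (rule DERIV_continuous_on [of _ _ "F 1"]) (use der [of _ 0] in auto)
  have "\<bar>G 0 b - G 0 a - (b - a) * G 1 ((a + b) / 2)\<bar> \<le> B * (b - a) ^ 3"
  proof (rule midpoint_difference_order3 [OF ab])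
    fix i x assume x: "x \<in> {a..b}" and i: "i \<le> (2::nat)"
    show "(G i has_real_derivative G (Suc i) x) (at x within {a..b})"
    proof (cases i)
      case 0
      then show ?thesis using integral_has_real_derivative [OF cont x] by (simp add: G_def)
    next
      case (Suc j)
      then show ?thesis using der [OF x, of j] i by (simp add: G_def)
    qed
  qed (use bd in \<open>simp add: G_def eval_nat_numeral\<close>)
  then show ?thesis by (simp add: G_def eval_nat_numeral)
qed

section \<open>The kernel u^(-\<alpha>) with its derivatives, first on one cell and then summed over
  all cells\<close>

definition frac_kernel :: "real \<Rightarrow> nat \<Rightarrow> real \<Rightarrow> real" where
  "frac_kernel \<alpha> i u = (- 1) ^ i * pochhammer \<alpha> i * u powr (- \<alpha> - real i)"

lemma frac_kernel_0: "frac_kernel \<alpha> 0 u = u powr (- \<alpha>)"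
  by (simp add: frac_kernel_def)

lemma frac_kernel_1: "frac_kernel \<alpha> (Suc 0) u = - \<alpha> * u powr (- \<alpha> - 1)"
  by (simp add: frac_kernel_def)

lemma frac_kernel_has_derivative:
  assumes "u > 0"
  shows "(frac_kernel \<alpha> i has_real_derivative frac_kernel \<alpha> (Suc i) u) (at u within S)"
proof -
  have "((\<lambda>u. u powr (- \<alpha> - real i)) has_real_derivative
      (- \<alpha> - real i) * u powr (- \<alpha> - real i - 1)) (at u)"
    by (rule has_real_derivative_powr [OF assms])
  from DERIV_cmult [OF this, of "(- 1) ^ i * pochhammer \<alpha> i"]
  have "(frac_kernel \<alpha> i has_real_derivative frac_kernel \<alpha> (Suc i) u) (at u)"
    by (simp add: frac_kernel_def [abs_def] pochhammer_Suc algebra_simps)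
  then show ?thesis by (rule DERIV_subset) simp
qed

text \<open>The midpoint value of the kernel is paired with the exact increment of \<open>W 0\<close>; both this and the
  integral are expanded at the midpoint, and the third-order terms that do not involve \<open>W 3\<close> are
  absorbed into the increment of the derivative of \<open>W 1 \<cdot> kernel\<close>.\<close>
lemma midpoint_kernel_cell:
  fixes W :: "nat \<Rightarrow> real \<Rightarrow> real"
  assumes a: "0 < a" "a \<le> b" and \<alpha>: "0 < \<alpha>"
    and der: "\<And>i x. x \<in> {a..b} \<Longrightarrow> i \<le> 4 \<Longrightarrow> (W i has_real_derivative W (Suc i) x) (at x within {a..b})"
    and bd: "\<And>i x. x \<in> {a..b} \<Longrightarrow> i \<le> 5 \<Longrightarrow> \<bar>W i x\<bar> \<le> M * x powr (4 - real i)"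
  shows "\<bar>frac_kernel \<alpha> 0 ((a + b) / 2) * (W 0 b - W 0 a)
      - integral {a..b} (\<lambda>u. W 1 u * frac_kernel \<alpha> 0 u)
      - (b - a)\<^sup>2 / 24 * integral {a..b} (\<lambda>u. W 3 u * frac_kernel \<alpha> 0 u)
      + (b - a)\<^sup>2 / 24 * ((W 2 b * frac_kernel \<alpha> 0 b + W 1 b * frac_kernel \<alpha> 1 b) - (W 2 a * frac_kernel \<alpha> 0 a + W 1 a * frac_kernel \<alpha> 1 a))\<bar>
    \<le> 64 * M * (\<Sum>i\<le>4. pochhammer \<alpha> i) * a powr (- 1 - \<alpha>) * (b - a) ^ 5"
proof -
  define c where "c = (\<Sum>i\<le>4. pochhammer \<alpha> i)"
  define m h where "m = (a + b) / 2" and "h = b - a"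
  define R where "R = M * c * a powr (- 1 - \<alpha>)"
  let ?p = "frac_kernel \<alpha>"
  have m: "m \<in> {a..b}" and h: "h \<ge> 0" using a by (auto simp: m_def h_def)
  have poch: "pochhammer \<alpha> i \<ge> 0" for i using \<alpha> by (intro pochhammer_nonneg) auto
  have c1: "pochhammer \<alpha> i \<le> c" if "i \<le> 4" for i
    unfolding c_def by (rule member_le_sum) (use that poch in auto)
  have c0: "c \<ge> 1" using c1 [of 0] by simp
  have "0 \<le> M * m powr (4 - real 0)" using bd [OF m, of 0] by linarith
  then have M: "M \<ge> 0" using a m by (simp add: zero_le_mult_iff)
  \<comment> \<open>All products of total order 5 have the same size, x^(4-i) x^(-\<alpha>-j) =
    x^(-1-\<alpha>), which is largest at the left end \<open>a\<close>.\<close>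
  have prod: "\<bar>W i x * ?p j x\<bar> \<le> R" if "x \<in> {a..b}" "i + j = 5" "j \<le> 4" for i j x
  proof -
    have "\<bar>W i x * ?p j x\<bar> = \<bar>W i x\<bar> * (pochhammer \<alpha> j * x powr (- \<alpha> - real j))"
      using poch by (simp add: frac_kernel_def abs_mult)
    also have "\<dots> \<le> (M * x powr (4 - real i)) * (c * x powr (- \<alpha> - real j))"
      using bd [OF that(1), of i] c1 [OF that(3)] M poch that by (intro mult_mono mult_right_mono) auto
    also have "\<dots> = M * c * (x powr (4 - real i) * x powr (- \<alpha> - real j))" by simp
    also have "x powr (4 - real i) * x powr (- \<alpha> - real j) = x powr (- 1 - \<alpha>)"
    proof -
      have "(4 - real i) + (- \<alpha> - real j) = - 1 - \<alpha>" using that(2) by linarith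
      then show ?thesis by (metis powr_add)
    qed
    also have "M * c * x powr (- 1 - \<alpha>) \<le> R"
      unfolding R_def using that(1) a \<alpha> M c0 by (intro mult_left_mono powr_mono2') auto
    finally show ?thesis .
  qed
  have R: "R \<ge> 0" using M c0 by (simp add: R_def)
  have pder: "(?p i has_real_derivative ?p (Suc i) x) (at x within {a..b})" if "x \<in> {a..b}" for i x
    using that a by (intro frac_kernel_has_derivative) auto
  define V where "V i j x = W i x * ?p j x" for i j x
  \<comment> \<open>Leibniz's rule: \<open>F i\<close> is the i-th derivative of W' times the
    kernel.\<close>
  define F where "F i x = (if i = 0 then V 1 0 x
      else if i = 1 then V 2 0 x + V 1 1 x
      else if i = 2 then V 3 0 x + 2 * (V 2 1 x) + V 1 2 x
      else if i = 3 then V 4 0 x + 3 * (V 3 1 x) + 3 * (V 2 2 x) + V 1 3 x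
      else V 5 0 x + 4 * (V 4 1 x) + 6 * (V 3 2 x) + 4 * (V 2 3 x) + V 1 4 x)"
    for i :: nat and x
  \<comment> \<open>\<open>Q 0\<close> is \<open>F 2\<close> without the term W''' times the kernel;
    \<open>Q 1\<close> and \<open>Q 2\<close> are its derivatives. Isolating it lets the integral of
    W''' times the kernel be traded for an increment of \<open>F 1\<close>.\<close>
  define Q where "Q i x = (if i = 0 then 2 * (V 2 1 x) + V 1 2 x
      else if i = 1 then 2 * (V 3 1 x) + 3 * (V 2 2 x) + V 1 3 x
      else 2 * (V 4 1 x) + 5 * (V 3 2 x) + 4 * (V 2 3 x) + V 1 4 x)"
    for i :: nat and x
  have V_der: "(V i j has_real_derivative V (Suc i) j x + V i (Suc j) x) (at x within {a..b})"
    if "x \<in> {a..b}" "i \<le> 4" for i j x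
    using DERIV_mult [OF der [OF that] pder [OF that(1), of j]] by (simp add: V_def [abs_def] algebra_simps)
  have der_F: "(F i has_real_derivative F (Suc i) x) (at x within {a..b})" if x: "x \<in> {a..b}" and "i \<le> 3" for i x
  proof -
    consider "i = 0" | "i = 1" | "i = 2" | "i = 3" using \<open>i \<le> 3\<close> by linarith
    then show ?thesis
      by cases (unfold F_def, auto intro!: derivative_eq_intros V_der x simp: eval_nat_numeral)
  qed
  have der_Q: "(Q i has_real_derivative Q (Suc i) x) (at x within {a..b})" if x: "x \<in> {a..b}" and "i \<le> 1" for i x
  proof -
    consider "i = 0" | "i = 1" using \<open>i \<le> 1\<close> by linarith
    then show ?thesis
      by cases (unfold Q_def, auto intro!: derivative_eq_intros V_der x simp: eval_nat_numeral)
  qed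
  \<comment> \<open>16 is the sum of the binomial coefficients in \<open>F 4\<close>; those of
    \<open>Q 2\<close> add up to 12.\<close>
  have F4: "\<bar>F 4 x\<bar> \<le> 16 * R" if "x \<in> {a..b}" for x
    using prod [OF that, of 5 0] prod [OF that, of 4 1] prod [OF that, of 3 2] prod [OF that, of 2 3] prod [OF that, of 1 4]
    unfolding F_def V_def by simp
  have Q2: "\<bar>Q 2 x\<bar> \<le> 16 * R" if "x \<in> {a..b}" for x
    using prod [OF that, of 4 1] prod [OF that, of 3 2] prod [OF that, of 2 3] prod [OF that, of 1 4] R
    unfolding Q_def V_def by simp
  have "(F 2 has_integral (F 1 b - F 1 a)) {a..b}"
    using a der_F [of _ 1]
    by (intro fundamental_theorem_of_calculus) (auto simp: eval_nat_numeral has_real_derivative_iff_has_vector_derivative)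
  moreover have "(Q 0 has_integral integral {a..b} (Q 0)) {a..b}"
  proof -
    have "continuous_on {a..b} (Q 0)"
      by (rule DERIV_continuous_on [of _ _ "Q 1"]) (use der_Q [of _ 0] in auto)
    then show ?thesis using integrable_continuous_real by blast
  qed
  ultimately have "((\<lambda>x. F 2 x - Q 0 x) has_integral (F 1 b - F 1 a - integral {a..b} (Q 0))) {a..b}"
    by (rule has_integral_diff)
  then have IQ: "integral {a..b} (\<lambda>u. W 3 u * ?p 0 u) = F 1 b - F 1 a - integral {a..b} (Q 0)"
    by (simp add: F_def Q_def V_def integral_unique)
  define e1 where "e1 = W 0 b - W 0 a - h * W 1 m - h ^ 3 / 24 * W 3 m"
  define e2 where "e2 = integral {a..b} (F 0) - h * F 0 m - h ^ 3 / 24 * F 2 m"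
  define e3 where "e3 = integral {a..b} (Q 0) - h * Q 0 m"
  have "\<bar>e1\<bar> \<le> M * a powr (- 1) * h ^ 5"
    unfolding e1_def m_def h_def
  proof (rule midpoint_difference_order5 [where G = W, OF a(2) der])
    fix x assume x: "x \<in> {a..b}"
    have "\<bar>W 5 x\<bar> \<le> M * x powr (- 1)" using bd [OF x, of 5] by simp
    also have "\<dots> \<le> M * a powr (- 1)"
      using x a M by (intro mult_left_mono powr_mono2') auto
    finally show "\<bar>W 5 x\<bar> \<le> M * a powr (- 1)" .
  qed
  moreover have p0: "0 \<le> ?p 0 m" "?p 0 m \<le> c * a powr (- \<alpha>)"
  proof -
    show "0 \<le> ?p 0 m" by (simp add: frac_kernel_0)
    have "?p 0 m \<le> a powr (- \<alpha>)" unfolding frac_kernel_0 using m a \<alpha> by (intro powr_mono2') auto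
    also have "\<dots> \<le> c * a powr (- \<alpha>)" using c0 mult_right_mono [of 1 c "a powr (- \<alpha>)"] by simp
    finally show "?p 0 m \<le> c * a powr (- \<alpha>)" .
  qed
  ultimately have "?p 0 m * \<bar>e1\<bar> \<le> (c * a powr (- \<alpha>)) * (M * a powr (- 1) * h ^ 5)"
    using c0 by (intro mult_mono) auto
  also have "\<dots> = M * c * (a powr (- 1) * a powr (- \<alpha>)) * h ^ 5" by simp
  also have "\<dots> = R * h ^ 5"
    unfolding R_def powr_add [symmetric] by simp
  finally have e1: "\<bar>?p 0 m * e1\<bar> \<le> R * h ^ 5" using p0 by (simp add: abs_mult)
  have e2: "\<bar>e2\<bar> \<le> 16 * R * h ^ 5"
    unfolding e2_def m_def h_def by (rule midpoint_rule_order5 [where F = F, OF a(2) der_F F4])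
  have "\<bar>e3\<bar> \<le> 16 * R * h ^ 3"
    unfolding e3_def m_def h_def by (rule midpoint_rule_order3 [where F = Q, OF a(2) der_Q Q2])
  then have "h\<^sup>2 / 24 * \<bar>e3\<bar> \<le> h\<^sup>2 / 24 * (16 * R * h ^ 3)" by (intro mult_left_mono) auto
  also have "\<dots> = 16 / 24 * (R * h ^ 5)" by (simp add: eval_nat_numeral)
  finally have e3: "\<bar>h\<^sup>2 / 24 * e3\<bar> \<le> 16 / 24 * (R * h ^ 5)" by (simp add: abs_mult)
  \<comment> \<open>The three midpoint contributions of order h^3 cancel because
    \<open>F 2 m = V 3 0 m + Q 0 m\<close>; only the remainders are left. Their constants 1, 16 and
    16/24 fit generously under 64.\<close>
  have "?p 0 m * (W 0 b - W 0 a) - integral {a..b} (F 0)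
      - h\<^sup>2 / 24 * integral {a..b} (\<lambda>u. W 3 u * ?p 0 u) + h\<^sup>2 / 24 * (F 1 b - F 1 a)
    = ?p 0 m * e1 - e2 + h\<^sup>2 / 24 * e3"
    unfolding IQ e1_def e2_def e3_def by (simp add: F_def Q_def V_def field_simps eval_nat_numeral)
  then have "\<bar>?p 0 m * (W 0 b - W 0 a) - integral {a..b} (F 0)
      - h\<^sup>2 / 24 * integral {a..b} (\<lambda>u. W 3 u * ?p 0 u) + h\<^sup>2 / 24 * (F 1 b - F 1 a)\<bar>
    \<le> 64 * (R * h ^ 5)"
    using e1 e2 e3 R zero_le_power [OF h, of 5] mult_nonneg_nonneg [OF R zero_le_power [OF h, of 5]] by linarith
  moreover have "F 0 = (\<lambda>u. W 1 u * ?p 0 u)" by (simp add: fun_eq_iff F_def V_def)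
  ultimately show ?thesis
    by (simp add: R_def F_def V_def m_def h_def c_def mult.assoc)
qed

lemma integral_split_cells:
  fixes f :: "real \<Rightarrow> real"
  assumes "h \<ge> 0" "f integrable_on {0..real n * h}"
  shows "integral {0..real n * h} f = (\<Sum>k<n. integral {real k * h..real (Suc k) * h} f)"
  using assms(2)
proof (induction n)
  case (Suc n)
  have le: "0 \<le> real n * h" "real n * h \<le> real (Suc n) * h"
    using assms(1) by (auto intro: mult_right_mono)
  have "f integrable_on {0..real n * h}"
    by (rule integrable_subinterval_real [OF Suc.prems]) (use le in auto)
  then show ?case
    using Suc.IH Henstock_Kurzweil_Integration.integral_combine [OF le Suc.prems] by simp
qed simp

text \<open>For k > 0 the cell estimate gives h^5 (k h)^(-1-\<alpha>) = h^(4-\<alpha>)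
  k^(-1-\<alpha>), summable over k. The cell at k = 0 touches the singularity and admits no such
  estimate, but there each term is separately O(h^(4-\<alpha>)) by the flatness of
  \<open>W\<close>.\<close>

lemma midpoint_kernel_sum_flat:
  fixes W :: "nat \<Rightarrow> real \<Rightarrow> real"
  assumes \<alpha>: "0 < \<alpha>" "\<alpha> < 1" and t: "0 < t"
    and der: "\<And>i x. x \<in> {0..t} \<Longrightarrow> i \<le> 4 \<Longrightarrow> (W i has_real_derivative W (Suc i) x) (at x within {0..t})"
    and bd: "\<And>i x. x \<in> {0<..t} \<Longrightarrow> i \<le> 5 \<Longrightarrow> \<bar>W i x\<bar> \<le> M * x powr (4 - real i)"
    and W0: "W 0 0 = 0"
    and int1: "(\<lambda>u. W 1 u * frac_kernel \<alpha> 0 u) integrable_on {0..t}"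
    and int3: "(\<lambda>u. W 3 u * frac_kernel \<alpha> 0 u) integrable_on {0..t}"
  shows "(\<lambda>n. (\<Sum>k<n. frac_kernel \<alpha> 0 ((real k + 1/2) * (t / real n)) * (W 0 (real (Suc k) * (t / real n)) - W 0 (real k * (t / real n))))
      - (integral {0..t} (\<lambda>u. W 1 u * frac_kernel \<alpha> 0 u)
         + (t / real n)\<^sup>2 / 24 * integral {0..t} (\<lambda>u. W 3 u * frac_kernel \<alpha> 0 u)
         - (t / real n)\<^sup>2 / 24 * (W 2 t * frac_kernel \<alpha> 0 t + W 1 t * frac_kernel \<alpha> 1 t)))
    \<in> O(\<lambda>n. (t / real n) powr (4 - \<alpha>))"
proof -
  define c where "c = (\<Sum>i\<le>4. pochhammer \<alpha> i)"
  define A where "A = (\<Sum>k. real k powr (- 1 - \<alpha>))"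
  have sA: "summable (\<lambda>k. real k powr (- 1 - \<alpha>))" using \<alpha> by (simp add: summable_real_powr_iff)
  have "0 \<le> M * t powr (4 - real 0)" using bd [of t 0] t by simp
  then have M: "M \<ge> 0" using t by (simp add: zero_le_mult_iff)
  have c: "c \<ge> 0" unfolding c_def using \<alpha> by (intro sum_nonneg pochhammer_nonneg) auto
  define D where "D u = W 2 u * frac_kernel \<alpha> 0 u + W 1 u * frac_kernel \<alpha> 1 u" for u
  \<comment> \<open>The convention \<open>0 powr z = 0\<close> makes the kernel and its derivatives
    vanish at 0, so the telescoping sum leaves the boundary term at \<open>t\<close> alone.\<close>
  have D0: "D 0 = 0" by (simp add: D_def frac_kernel_def)
  \<comment> \<open>6 = 2 + 1 + 1 + 2 collects the four terms of the first cell; the rest is the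
    cell constant times the full series.\<close>
  define K where "K = 6 * M + 64 * M * c * A"
  show ?thesis
  proof (rule bigoI [of _ K], rule eventually_mono [OF eventually_gt_at_top [of 0]])
    fix n :: nat assume n: "n > 0"
    define h where "h = t / real n"
    have h: "h > 0" "real n * h = t" "h \<le> t" using n t by (auto simp: h_def field_simps)
    let ?H = "h powr (4 - \<alpha>)"
    define E where "E k = frac_kernel \<alpha> 0 ((real k + 1/2) * h) * (W 0 (real (Suc k) * h) - W 0 (real k * h))
      - integral {real k * h..real (Suc k) * h} (\<lambda>u. W 1 u * frac_kernel \<alpha> 0 u)
      - h\<^sup>2 / 24 * integral {real k * h..real (Suc k) * h} (\<lambda>u. W 3 u * frac_kernel \<alpha> 0 u)
      + h\<^sup>2 / 24 * (D (real (Suc k) * h) - D (real k * h))" for k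
    have E: "\<bar>E k\<bar> \<le> (64 * M * c * ?H) * real k powr (- 1 - \<alpha>)" if k: "0 < k" "k < n" for k
    proof -
      let ?a = "real k * h" and ?b = "real (Suc k) * h"
      have "real (Suc k) * h \<le> real n * h" using h k by (intro mult_right_mono) auto
      then have bt: "?b \<le> t" using h by simp
      have ap: "0 < ?a" "?a \<le> ?b" using h k by (auto intro: mult_right_mono)
      have sub: "0 < ?a" "?a \<le> ?b" "{?a..?b} \<subseteq> {0..t}" "{?a..?b} \<subseteq> {0<..t}"
        using ap less_imp_le [OF ap(1)] bt order.trans [OF _ bt] order.trans [OF less_imp_le [OF ap(1)]] less_le_trans [OF ap(1)] by (auto simp del: of_nat_Suc)
      have ab: "?b - ?a = h" "(?a + ?b) / 2 = (real k + 1/2) * h"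
        by (simp_all add: field_simps)
      have der': "(W i has_real_derivative W (Suc i) x) (at x within {?a..?b})"
        if "x \<in> {?a..?b}" "i \<le> 4" for i x
        using DERIV_subset [OF der [OF subsetD [OF sub(3) that(1)] that(2)] sub(3)] .
      have bd': "\<bar>W i x\<bar> \<le> M * x powr (4 - real i)" if "x \<in> {?a..?b}" "i \<le> 5" for i x
        using bd [OF subsetD [OF sub(4) that(1)] that(2)] .
      have "?a powr (- 1 - \<alpha>) * h ^ 5 = real k powr (- 1 - \<alpha>) * ?H"
      proof -
        have "h powr (- 1 - \<alpha>) * h ^ 5 = h powr (- 1 - \<alpha>) * h powr 5" using h by simp
        also have "\<dots> = ?H" by (simp flip: powr_add)
        finally show ?thesis using h by (simp add: powr_mult)
      qed
      then have pw: "64 * M * c * ?a powr (- 1 - \<alpha>) * h ^ 5 = (64 * M * c * ?H) * real k powr (- 1 - \<alpha>)"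
        by simp
      have "\<bar>E k\<bar> \<le> 64 * M * c * ?a powr (- 1 - \<alpha>) * h ^ 5"
        unfolding E_def D_def c_def
        by (rule midpoint_kernel_cell [where W = W, OF sub(1,2) \<alpha>(1) der' bd', unfolded ab])
      also note pw
      finally show ?thesis .
    qed
    have E0: "\<bar>E 0\<bar> \<le> 6 * M * ?H"
    proof -
      have w: "\<bar>W i u\<bar> \<le> M * u powr (4 - real i)" if "0 < u" "u \<le> h" "i \<le> 5" for i u
        using bd [of u i] that h by simp
      have "\<bar>frac_kernel \<alpha> 0 (h / 2) * W 0 h\<bar> \<le> (2 * h powr (- \<alpha>)) * (M * h powr 4)"
      proof -
        have "frac_kernel \<alpha> 0 (h / 2) = 2 powr \<alpha> * h powr (- \<alpha>)"
          unfolding frac_kernel_0 using h by (subst powr_divide) (auto simp: powr_minus divide_inverse)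
        also have "\<dots> \<le> 2 * h powr (- \<alpha>)"
          using powr_mono [of \<alpha> 1 "2::real"] \<alpha> by (intro mult_right_mono) auto
        finally show ?thesis
          unfolding abs_mult using w [of h 0] h by (intro mult_mono) (auto simp: frac_kernel_0)
      qed
      also have "\<dots> = 2 * M * (h powr (- \<alpha>) * h powr 4)" by simp
      also have "h powr (- \<alpha>) * h powr 4 = ?H" by (simp flip: powr_add)
      finally have 1: "\<bar>frac_kernel \<alpha> 0 (h / 2) * W 0 h\<bar> \<le> 2 * M * ?H" .
      have ib: "\<bar>integral {0..h} (\<lambda>u. W i u * frac_kernel \<alpha> 0 u)\<bar> \<le> M * h powr (5 - real i - \<alpha>)"
        if "(\<lambda>u. W i u * frac_kernel \<alpha> 0 u) integrable_on {0..t}" and i: "i \<le> 3" for i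
      proof -
        have "norm (integral {0..h} (\<lambda>u. W i u * frac_kernel \<alpha> 0 u)) \<le> integral {0..h} (\<lambda>_. M * h powr (4 - real i - \<alpha>))"
        proof (rule integral_norm_bound_integral)
          show "(\<lambda>u. W i u * frac_kernel \<alpha> 0 u) integrable_on {0..h}"
            by (rule integrable_subinterval_real [OF that(1)]) (use h in auto)
          fix u assume u: "u \<in> {0..h}"
          show "norm (W i u * frac_kernel \<alpha> 0 u) \<le> M * h powr (4 - real i - \<alpha>)"
          proof (cases "u = 0")
            case False
            have "norm (W i u * frac_kernel \<alpha> 0 u) = \<bar>W i u\<bar> * u powr (- \<alpha>)" by (simp add: frac_kernel_0 abs_mult)
            also have "\<dots> \<le> (M * u powr (4 - real i)) * u powr (- \<alpha>)"
              using w [of u i] u i False by (intro mult_right_mono) auto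
            also have "\<dots> = M * u powr (4 - real i - \<alpha>)" by (simp flip: powr_add)
            \<comment> \<open>The exponent is positive, for i = 3 because \<alpha> < 1, so the power
              increases with u.\<close>
            also have "\<dots> \<le> M * h powr (4 - real i - \<alpha>)"
              using u i \<alpha> M by (intro mult_left_mono powr_mono2) auto
            finally show ?thesis .
          qed (use M in \<open>simp add: frac_kernel_0\<close>)
        qed auto
        also have "\<dots> = M * (h powr 1 * h powr (4 - real i - \<alpha>))" using h by simp
        also have "h powr 1 * h powr (4 - real i - \<alpha>) = h powr (5 - real i - \<alpha>)"
          by (simp only: powr_add [symmetric]) (simp add: algebra_simps)
        finally show ?thesis by simp
      qed
      have h2: "h\<^sup>2 * h powr (2 - \<alpha>) = ?H"
      proof -
        have "h\<^sup>2 * h powr (2 - \<alpha>) = h powr 2 * h powr (2 - \<alpha>)" using h by simp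
        then show ?thesis by (simp flip: powr_add)
      qed
      have 2: "\<bar>integral {0..h} (\<lambda>u. W 1 u * frac_kernel \<alpha> 0 u)\<bar> \<le> M * ?H"
        using ib [OF int1] by simp
      have "\<bar>h\<^sup>2 / 24 * integral {0..h} (\<lambda>u. W 3 u * frac_kernel \<alpha> 0 u)\<bar> \<le> h\<^sup>2 * (M * h powr (2 - \<alpha>))"
        unfolding abs_mult using ib [OF int3] by (intro mult_mono) auto
      then have 3: "\<bar>h\<^sup>2 / 24 * integral {0..h} (\<lambda>u. W 3 u * frac_kernel \<alpha> 0 u)\<bar> \<le> M * ?H"
        using h2 by (simp add: mult.left_commute)
      have "\<bar>D h\<bar> \<le> 2 * M * h powr (2 - \<alpha>)"
      proof -
        have "\<bar>W 2 h * frac_kernel \<alpha> 0 h\<bar> \<le> (M * h powr 2) * h powr (- \<alpha>)"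
          unfolding abs_mult frac_kernel_0 using w [of h 2] h by (intro mult_mono) auto
        moreover have "\<bar>W 1 h * frac_kernel \<alpha> 1 h\<bar> \<le> (M * h powr 3) * (1 * h powr (- \<alpha> - 1))"
          unfolding abs_mult One_nat_def frac_kernel_1 using w [of h 1] h \<alpha> M
          by (intro mult_mono) auto
        moreover have "(M * h powr 2) * h powr (- \<alpha>) = M * h powr (2 - \<alpha>)"
          by (simp only: mult.assoc powr_add [symmetric]) simp
        moreover have "(M * h powr 3) * (1 * h powr (- \<alpha> - 1)) = M * h powr (2 - \<alpha>)"
          by (simp only: mult.assoc mult_1 powr_add [symmetric]) simp
        ultimately show ?thesis unfolding D_def by linarith
      qed
      then have "\<bar>h\<^sup>2 / 24 * D h\<bar> \<le> h\<^sup>2 * (2 * M * h powr (2 - \<alpha>))"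
        unfolding abs_mult by (intro mult_mono) auto
      then have 4: "\<bar>h\<^sup>2 / 24 * D h\<bar> \<le> 2 * M * ?H"
        using h2 by (simp add: mult.left_commute)
      have "E 0 = frac_kernel \<alpha> 0 (h / 2) * W 0 h - integral {0..h} (\<lambda>u. W 1 u * frac_kernel \<alpha> 0 u)
          - h\<^sup>2 / 24 * integral {0..h} (\<lambda>u. W 3 u * frac_kernel \<alpha> 0 u) + h\<^sup>2 / 24 * D h"
        by (simp add: E_def W0 D0)
      then show ?thesis using 1 2 3 4 by linarith
    qed
    have "(\<Sum>k<n. E k) = (\<Sum>k<n. frac_kernel \<alpha> 0 ((real k + 1/2) * h) * (W 0 (real (Suc k) * h) - W 0 (real k * h)))
        - integral {0..t} (\<lambda>u. W 1 u * frac_kernel \<alpha> 0 u)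
        - h\<^sup>2 / 24 * integral {0..t} (\<lambda>u. W 3 u * frac_kernel \<alpha> 0 u)
        + h\<^sup>2 / 24 * (D t - D 0)"
    proof -
      have tel: "(\<Sum>k<n. D (real (Suc k) * h) - D (real k * h)) = D t - D 0"
        using sum_lessThan_telescope [of "\<lambda>k. D (real k * h)" n] h by simp
      have "integral {0..t} f = (\<Sum>k<n. integral {real k * h..real (Suc k) * h} f)"
        if "f integrable_on {0..t}" for f :: "real \<Rightarrow> real"
        using integral_split_cells [of h f n] that h by simp
      note I = this [OF int1] this [OF int3]
      show ?thesis
        unfolding E_def sum.distrib sum_subtractf sum_distrib_left [symmetric] tel [unfolded sum_subtractf] I ..
    qed
    moreover have "\<bar>\<Sum>k<n. E k\<bar> \<le> K * ?H"
    proof -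
      have "\<bar>\<Sum>k<n. E k\<bar> \<le> (\<Sum>k<n. \<bar>E k\<bar>)" by (rule sum_abs)
      also have "\<dots> \<le> (\<Sum>k<n. (if k = 0 then 6 * M * ?H else 0) + (64 * M * c * ?H) * real k powr (- 1 - \<alpha>))"
        using E E0 by (intro sum_mono) auto
      also have "\<dots> = 6 * M * ?H + (64 * M * c * ?H) * (\<Sum>k<n. real k powr (- 1 - \<alpha>))"
        using n by (simp add: sum.distrib sum_distrib_left)
      also have "\<dots> \<le> 6 * M * ?H + (64 * M * c * ?H) * A"
        unfolding A_def using M c by (intro add_left_mono mult_left_mono sum_le_suminf [OF sA]) auto
      also have "\<dots> = K * ?H" by (simp add: K_def algebra_simps)
      finally show ?thesis .
    qed
    ultimately show "norm ((\<Sum>k<n. frac_kernel \<alpha> 0 ((real k + 1/2) * (t / real n)) * (W 0 (real (Suc k) * (t / real n)) - W 0 (real k * (t / real n))))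
      - (integral {0..t} (\<lambda>u. W 1 u * frac_kernel \<alpha> 0 u)
         + (t / real n)\<^sup>2 / 24 * integral {0..t} (\<lambda>u. W 3 u * frac_kernel \<alpha> 0 u)
         - (t / real n)\<^sup>2 / 24 * (W 2 t * frac_kernel \<alpha> 0 t + W 1 t * frac_kernel \<alpha> 1 t)))
      \<le> K * norm ((t / real n) powr (4 - \<alpha>))"
      unfolding h_def [symmetric] D0 by (simp add: D_def algebra_simps)
  qed
qed

section \<open>Fractional integrals\<close>

text \<open>Substitute u = \<tau> w^\<beta> with \<beta> = 1/(1 - \<alpha>). As \<beta> (1 -
  \<alpha>) = 1, the Jacobian cancels the singular kernel up to a constant. Integrability of f(u)
  u^(-\<alpha>) for continuous f is obtained at the same time.\<close>

lemma fractional_integral_substitution: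
  fixes f :: "real \<Rightarrow> real"
  assumes \<alpha>: "0 < \<alpha>" "\<alpha> < 1" and \<tau>: "0 < \<tau>" and f: "continuous_on {0..\<tau>} f"
  shows "((\<lambda>u. f u * u powr (- \<alpha>)) has_integral
      \<tau> powr (1 - \<alpha>) / (1 - \<alpha>) * integral {0..1} (\<lambda>w. f (\<tau> * w powr (1 / (1 - \<alpha>))))) {0..\<tau>}"
proof -
  define \<beta> where "\<beta> = 1 / (1 - \<alpha>)"
  have \<beta>: "\<beta> > 1" "\<beta> * (1 - \<alpha>) = 1" using \<alpha> by (auto simp: \<beta>_def field_simps)
  define g where "g w = \<tau> * w powr \<beta>" for w
  define F where "F u = f u * u powr (- \<alpha>)" for u
  \<comment> \<open>The derivative of w^\<beta> is taken only for w > 0; the missing end point is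
    put back later as a null set.\<close>
  let ?S = "{0<..1::real}"
  have der: "(g has_field_derivative \<tau> * (\<beta> * w powr (\<beta> - 1))) (at w within ?S)" if "w \<in> ?S" for w
    unfolding g_def using that
    by (intro DERIV_cmult has_field_derivative_at_within [OF has_real_derivative_powr]) auto
  have inj: "inj_on g ?S"
    using \<tau> \<beta> by (auto simp: inj_on_def g_def)
      (metis powr_powr powr_one less_imp_le mult.commute nonzero_eq_divide_eq less_irrefl zero_less_one order.strict_trans)
  have img: "g ` ?S = {0<..\<tau>}"
  proof (intro equalityI subsetI)
    fix u assume "u \<in> g ` ?S"
    then obtain w where w: "0 < w" "w \<le> 1" "u = g w" by auto
    have "w powr \<beta> \<le> 1 powr \<beta>" using w \<beta> by (intro powr_mono2) auto
    then show "u \<in> {0<..\<tau>}" using w \<tau> by (simp add: g_def)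
  next
    fix u assume u: "u \<in> {0<..\<tau>}"
    define w where "w = (u / \<tau>) powr (1 - \<alpha>)"
    have "w powr \<beta> = u / \<tau>" using u \<tau> \<beta> by (simp add: w_def powr_powr mult.commute)
    then have "u = g w" using \<tau> by (simp add: g_def)
    moreover have "(u / \<tau>) powr (1 - \<alpha>) \<le> 1 powr (1 - \<alpha>)" using u \<tau> \<alpha> by (intro powr_mono2) auto
    then have "w \<in> ?S" using u \<tau> by (simp add: w_def)
    ultimately show "u \<in> g ` ?S" by blast
  qed
  define c where "c = \<tau> powr (1 - \<alpha>) * \<beta>"
  have integrand: "\<bar>\<tau> * (\<beta> * w powr (\<beta> - 1))\<bar> * F (g w) = c * f (g w)" if "w \<in> ?S" for w
  proof -
    have "w powr (\<beta> - 1) * (w powr \<beta>) powr (- \<alpha>) = 1"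
    proof -
      have "\<beta> - 1 + \<beta> * (- \<alpha>) = 0" using \<beta>(2) by (simp add: algebra_simps)
      then show ?thesis using that by (simp add: powr_powr flip: powr_add)
    qed
    moreover have "\<tau> * \<tau> powr (- \<alpha>) = \<tau> powr (1 - \<alpha>)"
      using \<tau> by (simp add: powr_diff powr_minus field_simps)
    ultimately show ?thesis
      using that \<tau> \<beta> unfolding F_def g_def c_def
      by (simp add: powr_mult abs_mult) (metis (no_types, opaque_lifting) mult.assoc mult.commute mult.right_neutral)
  qed
  have cont: "continuous_on {0..1} (\<lambda>w. c * f (g w))"
  proof -
    have "continuous_on {0..1} g" unfolding g_def using \<beta> by (intro continuous_intros continuous_on_powr') auto
    moreover have "g ` {0..1} \<subseteq> {0..\<tau>}"
    proof
      fix u assume "u \<in> g ` {0..1}"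
      then obtain w where w: "0 \<le> w" "w \<le> 1" "u = g w" by auto
      have "w powr \<beta> \<le> 1 powr \<beta>" using w \<beta> by (intro powr_mono2) auto
      then show "u \<in> {0..\<tau>}" using w \<tau> by (simp add: g_def)
    qed
    ultimately show ?thesis
      by (intro continuous_intros continuous_on_compose2 [OF f])
  qed
  have neg: "negligible ({0<..b} - {0..b} \<union> ({0..b} - {0<..b}))" for b :: real
    by (rule negligible_subset [of "{0}"]) auto
  have "(\<lambda>w. c * f (g w)) absolutely_integrable_on {0..1}"
    by (rule absolutely_integrable_continuous_real [OF cont])
  then have "(\<lambda>w. c * f (g w)) absolutely_integrable_on ?S"
    by (rule set_integrable_subset) auto
  then have ai: "(\<lambda>w. \<bar>\<tau> * (\<beta> * w powr (\<beta> - 1))\<bar> * F (g w)) absolutely_integrable_on ?S"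
    by (rule absolutely_integrable_spike [OF _ negligible_empty]) (use integrand in auto)
  have val: "integral ?S (\<lambda>w. \<bar>\<tau> * (\<beta> * w powr (\<beta> - 1))\<bar> * F (g w)) = c * integral {0..1} (\<lambda>w. f (g w))"
  proof -
    have "integral ?S (\<lambda>w. \<bar>\<tau> * (\<beta> * w powr (\<beta> - 1))\<bar> * F (g w)) = integral ?S (\<lambda>w. c * f (g w))"
      by (rule integral_cong) (rule integrand)
    also have "\<dots> = integral {0..1} (\<lambda>w. c * f (g w))"
      by (rule integral_spike_set; rule negligible_subset [of "{0}"]) auto
    finally show ?thesis by simp
  qed
  have "F absolutely_integrable_on (g ` ?S) \<and> integral (g ` ?S) F = c * integral {0..1} (\<lambda>w. f (g w))"
    using has_absolute_integral_change_of_variables_1' [OF _ der inj, of F "c * integral {0..1} (\<lambda>w. f (g w))"] ai val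
    by simp
  then have "(F has_integral c * integral {0..1} (\<lambda>w. f (g w))) {0<..\<tau>}"
    unfolding img by (metis set_lebesgue_integral_eq_integral(1) has_integral_integral)
  then have "(F has_integral c * integral {0..1} (\<lambda>w. f (g w))) {0..\<tau>}"
    by (subst (asm) has_integral_spike_set_eq; force intro: negligible_subset [of "{0}"])
  then show ?thesis by (simp add: F_def [abs_def] c_def g_def \<beta>_def)
qed

text \<open>Up to the factor \<Gamma>(1 - \<alpha>) this is the Riemann-Liouville integral of order
  1 - \<alpha>. The reflected form places the singularity at the fixed end u = 0.\<close>

definition fractional_integral :: "real \<Rightarrow> (real \<Rightarrow> real) \<Rightarrow> real \<Rightarrow> real" where
  "fractional_integral \<alpha> f \<tau> = integral {0..\<tau>} (\<lambda>u. f (\<tau> - u) * u powr (- \<alpha>))"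

lemma fractional_integral_substituted:
  assumes "0 < \<alpha>" "\<alpha> < 1" and "0 < \<tau>" and "continuous_on {0..\<tau>} f"
  shows "fractional_integral \<alpha> f \<tau>
    = \<tau> powr (1 - \<alpha>) / (1 - \<alpha>) * integral {0..1} (\<lambda>w. f (\<tau> * (1 - w powr (1 / (1 - \<alpha>)))))"
proof -
  have "continuous_on {0..\<tau>} (\<lambda>u. f (\<tau> - u))"
    by (rule continuous_on_compose2 [OF assms(4)]) (auto intro!: continuous_intros)
  from fractional_integral_substitution [OF assms(1-3) this] show ?thesis
    by (simp add: fractional_integral_def integral_unique right_diff_distrib)
qed

lemma has_integral_reflect_right:
  fixes f :: "real \<Rightarrow> real"
  assumes "(f has_integral I) {0..\<tau>}"
  shows "((\<lambda>x. f (\<tau> - x)) has_integral I) {0..\<tau>}"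
proof -
  have "(\<lambda>x. \<tau> - x) ` {0..\<tau>} = {0..\<tau>}"
    by (auto simp: image_iff intro: bexI [of _ "\<tau> - x" for x])
  then show ?thesis
    using has_integral_affinity [of f I 0 \<tau> "-1" \<tau>] assms by (simp add: algebra_simps)
qed

text \<open>In the substituted form the kernel is gone and the integral can be differentiated under the
  integral sign; an integration by parts of \<open>w \<cdot> f (\<tau> (1 - w\<^sup>\<beta>))\<close> brings the result back.\<close>
lemma fractional_integral_has_derivative:
  assumes \<alpha>: "0 < \<alpha>" "\<alpha> < 1" and \<tau>: "0 < \<tau>" "\<tau> < T"
    and der: "\<And>x. x \<in> {0..T} \<Longrightarrow> (f has_real_derivative f' x) (at x within {0..T})"
    and f': "continuous_on {0..T} f'" and f0: "f 0 = 0"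
  shows "(fractional_integral \<alpha> f has_real_derivative fractional_integral \<alpha> f' \<tau>) (at \<tau>)"
proof -
  define \<beta> where "\<beta> = 1 / (1 - \<alpha>)"
  have \<beta>: "\<beta> > 1" "\<beta> * (1 - \<alpha>) = 1" "\<beta> \<noteq> 0" using \<alpha> by (auto simp: \<beta>_def field_simps)
  let ?U = "{0<..<T}"
  let ?I = "\<lambda>f \<tau>. integral {0..1} (\<lambda>w. f (\<tau> * (1 - w powr \<beta>)))"
  have f: "continuous_on {0..T} f" by (rule DERIV_continuous_on [OF der])
  have FI: "fractional_integral \<alpha> h \<sigma> = \<beta> * \<sigma> powr (1 - \<alpha>) * ?I h \<sigma>"
    if "continuous_on {0..T} h" "\<sigma> \<in> ?U" for h \<sigma>
    using fractional_integral_substituted [OF \<alpha>, of \<sigma> h] continuous_on_subset [OF that(1), of "{0..\<sigma>}"] that(2)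
    by (simp add: \<beta>_def)
  have pw: "0 \<le> w powr \<beta>" "w powr \<beta> \<le> 1" if "w \<in> {0..1}" for w
    using that \<beta> powr_mono2 [of \<beta> w 1] by auto
  have arg: "\<sigma> * (1 - w powr \<beta>) \<in> {0..T}" if "w \<in> {0..1}" "\<sigma> \<in> ?U" for w \<sigma>
  proof -
    have "\<sigma> * (1 - w powr \<beta>) \<le> \<sigma> * 1"
      using pw [OF that(1)] that(2) by (intro mult_left_mono) auto
    moreover have "0 \<le> \<sigma> * (1 - w powr \<beta>)"
      using pw [OF that(1)] that(2) by (intro mult_nonneg_nonneg) auto
    moreover have "\<sigma> * 1 \<le> T" using that(2) by simp
    ultimately show ?thesis unfolding atLeastAtMost_iff by (blast intro: order.trans)
  qed
  have cont_w: "continuous_on {0..1} (\<lambda>w. h (\<tau> * (1 - w powr \<beta>)))" if "continuous_on {0..T} h" for h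
    by (rule continuous_on_compose2 [OF that]) (use \<beta> \<tau> arg in \<open>auto intro!: continuous_intros continuous_on_powr'\<close>)
  have dI: "((\<lambda>\<sigma>. ?I f \<sigma>) has_real_derivative integral {0..1} (\<lambda>w. (1 - w powr \<beta>) * f' (\<tau> * (1 - w powr \<beta>)))) (at \<tau>)"
  proof -
    have "((\<lambda>\<sigma>. integral (cbox 0 1) (\<lambda>w. f (\<sigma> * (1 - w powr \<beta>)))) has_real_derivative
        integral (cbox 0 1) (\<lambda>w. (1 - w powr \<beta>) * f' (\<tau> * (1 - w powr \<beta>)))) (at \<tau> within ?U)"
    proof (rule leibniz_rule_field_derivative [where fx = "\<lambda>\<sigma> w. (1 - w powr \<beta>) * f' (\<sigma> * (1 - w powr \<beta>))"])
      fix \<sigma> w :: real assume \<sigma>: "\<sigma> \<in> ?U" and "w \<in> cbox 0 1"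
      then have w: "w \<in> {0..1}" by simp
      have "(\<lambda>\<sigma>. \<sigma> * (1 - w powr \<beta>)) ` ?U \<subseteq> {0..T}" using arg [OF w] by auto
      then have "(f has_real_derivative f' (\<sigma> * (1 - w powr \<beta>)))
          (at (\<sigma> * (1 - w powr \<beta>)) within (\<lambda>\<sigma>. \<sigma> * (1 - w powr \<beta>)) ` ?U)"
        by (rule DERIV_subset [OF der [OF arg [OF w \<sigma>]]])
      moreover have "((\<lambda>\<sigma>. \<sigma> * (1 - w powr \<beta>)) has_real_derivative (1 - w powr \<beta>)) (at \<sigma> within ?U)"
        by (auto intro!: derivative_eq_intros)
      ultimately have "((\<lambda>\<sigma>. f (\<sigma> * (1 - w powr \<beta>))) has_real_derivative
          f' (\<sigma> * (1 - w powr \<beta>)) * (1 - w powr \<beta>)) (at \<sigma> within ?U)"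
        by (rule DERIV_image_chain [unfolded o_def])
      then show "((\<lambda>\<sigma>. f (\<sigma> * (1 - w powr \<beta>))) has_real_derivative
          (1 - w powr \<beta>) * f' (\<sigma> * (1 - w powr \<beta>))) (at \<sigma> within ?U)"
        by (simp only: mult.commute)
    next
      fix \<sigma> assume \<sigma>: "\<sigma> \<in> ?U"
      show "(\<lambda>w. f (\<sigma> * (1 - w powr \<beta>))) integrable_on cbox 0 1"
        by (rule integrable_continuous, rule continuous_on_compose2 [OF f])
          (use \<beta> \<sigma> arg in \<open>auto intro!: continuous_intros continuous_on_powr'\<close>)
    next
      have "continuous_on (?U \<times> cbox 0 1) (\<lambda>z. (1 - snd z powr \<beta>) * f' (fst z * (1 - snd z powr \<beta>)))"
        by (intro continuous_on_mult continuous_on_compose2 [OF f'])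
          (use \<beta> arg in \<open>auto intro!: continuous_intros continuous_on_powr'\<close>)
      then show "continuous_on (?U \<times> cbox 0 1) (\<lambda>(\<sigma>, w). (1 - w powr \<beta>) * f' (\<sigma> * (1 - w powr \<beta>)))"
        by (simp add: case_prod_unfold)
    qed (use \<tau> in auto)
    then show ?thesis using \<tau> by (simp add: at_within_open [of _ ?U])
  qed
  \<comment> \<open>Integration by parts with the antiderivative w of 1. The boundary term at w = 1
    is f(0) = 0, and at w = 0 the factor w vanishes.\<close>
  have parts: "?I f \<tau> = \<beta> * \<tau> * integral {0..1} (\<lambda>w. w powr \<beta> * f' (\<tau> * (1 - w powr \<beta>)))"
  proof -
    have "((\<lambda>w. f (\<tau> * (1 - w powr \<beta>)) - \<beta> * \<tau> * (w powr \<beta> * f' (\<tau> * (1 - w powr \<beta>)))) has_integral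
        (1 * f (\<tau> * (1 - 1 powr \<beta>)) - 0 * f (\<tau> * (1 - 0 powr \<beta>)))) {0..1}"
    proof (rule fundamental_theorem_of_calculus_interior)
      show "continuous_on {0..1} (\<lambda>w. w * f (\<tau> * (1 - w powr \<beta>)))"
        by (intro continuous_intros cont_w [OF f])
      fix w :: real assume w: "w \<in> {0<..<1}"
      have "(f has_real_derivative f' (\<tau> * (1 - w powr \<beta>))) (at (\<tau> * (1 - w powr \<beta>)))"
      proof -
        have "w powr \<beta> < 1 powr \<beta>" using w \<beta> by (intro powr_less_mono2) auto
        moreover have "\<tau> * (1 - w powr \<beta>) \<le> \<tau> * 1" using \<tau> by (intro mult_left_mono) auto
        then have "\<tau> * (1 - w powr \<beta>) < T" using \<tau> by linarith
        ultimately have "0 < \<tau> * (1 - w powr \<beta>)" "\<tau> * (1 - w powr \<beta>) < T"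
          using \<tau> by (simp_all only: mult_pos_pos powr_one_eq_one diff_gt_0_iff_gt)
        then have "\<tau> * (1 - w powr \<beta>) \<in> {0<..<T}" by simp
        moreover from this have "\<tau> * (1 - w powr \<beta>) \<in> {0..T}" by auto
        ultimately show ?thesis using der at_within_Icc_at by (metis greaterThanLessThan_iff)
      qed
      moreover have "((\<lambda>w. \<tau> * (1 - w powr \<beta>)) has_real_derivative \<tau> * (0 - \<beta> * w powr (\<beta> - 1))) (at w)"
        using w by (intro DERIV_cmult DERIV_diff DERIV_const has_real_derivative_powr) auto
      ultimately have "((\<lambda>w. f (\<tau> * (1 - w powr \<beta>))) has_real_derivative
          f' (\<tau> * (1 - w powr \<beta>)) * (\<tau> * (0 - \<beta> * w powr (\<beta> - 1)))) (at w)"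
        by (rule DERIV_chain2)
      from DERIV_mult [OF DERIV_ident this]
      have "((\<lambda>w. w * f (\<tau> * (1 - w powr \<beta>))) has_real_derivative
          f (\<tau> * (1 - w powr \<beta>)) - \<beta> * \<tau> * (w * w powr (\<beta> - 1) * f' (\<tau> * (1 - w powr \<beta>)))) (at w)"
        by (rule DERIV_cong) (simp add: algebra_simps)
      moreover have "w * w powr (\<beta> - 1) = w powr \<beta>"
        using w by (simp add: powr_diff)
      ultimately show "((\<lambda>w. w * f (\<tau> * (1 - w powr \<beta>))) has_vector_derivative
          f (\<tau> * (1 - w powr \<beta>)) - \<beta> * \<tau> * (w powr \<beta> * f' (\<tau> * (1 - w powr \<beta>)))) (at w)"
        by (simp add: has_real_derivative_iff_has_vector_derivative)
    qed simp
    then have "integral {0..1} (\<lambda>w. f (\<tau> * (1 - w powr \<beta>)) - \<beta> * \<tau> * (w powr \<beta> * f' (\<tau> * (1 - w powr \<beta>)))) = 0"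
      using f0 by (simp add: integral_unique)
    moreover have "(\<lambda>w. f (\<tau> * (1 - w powr \<beta>))) integrable_on {0..1}"
      by (rule integrable_continuous_real [OF cont_w [OF f]])
    moreover have "(\<lambda>w. \<beta> * \<tau> * (w powr \<beta> * f' (\<tau> * (1 - w powr \<beta>)))) integrable_on {0..1}"
      using \<beta> by (intro integrable_continuous_real continuous_intros continuous_on_powr' cont_w [OF f']) auto
    ultimately show ?thesis by (simp add: integral_diff)
  qed
  have split: "integral {0..1} (\<lambda>w. (1 - w powr \<beta>) * f' (\<tau> * (1 - w powr \<beta>)))
      = ?I f' \<tau> - integral {0..1} (\<lambda>w. w powr \<beta> * f' (\<tau> * (1 - w powr \<beta>)))"
  proof -
    have "(\<lambda>w. w powr \<beta> * f' (\<tau> * (1 - w powr \<beta>))) integrable_on {0..1}"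
      using \<beta> by (intro integrable_continuous_real continuous_intros continuous_on_powr' cont_w [OF f']) auto
    moreover have "(\<lambda>w. f' (\<tau> * (1 - w powr \<beta>))) integrable_on {0..1}"
      by (rule integrable_continuous_real [OF cont_w [OF f']])
    ultimately show ?thesis by (simp add: left_diff_distrib integral_diff)
  qed
  have "((\<lambda>\<sigma>. \<beta> * (\<sigma> powr (1 - \<alpha>)) * ?I f \<sigma>) has_real_derivative
      (\<beta> * ((1 - \<alpha>) * \<tau> powr (1 - \<alpha> - 1))) * ?I f \<tau>
      + integral {0..1} (\<lambda>w. (1 - w powr \<beta>) * f' (\<tau> * (1 - w powr \<beta>))) * (\<beta> * \<tau> powr (1 - \<alpha>))) (at \<tau>)"
    by (rule DERIV_mult [OF DERIV_cmult [OF has_real_derivative_powr [OF \<tau>(1)]] dI])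
  \<comment> \<open>After integration by parts the derivative of the prefactor contributes f' with
    weight w^\<beta>; differentiation under the integral contributes weight 1 - w^\<beta>. Together
    they restore f' with weight 1.\<close>
  moreover have "(\<beta> * ((1 - \<alpha>) * \<tau> powr (1 - \<alpha> - 1))) * ?I f \<tau>
      + integral {0..1} (\<lambda>w. (1 - w powr \<beta>) * f' (\<tau> * (1 - w powr \<beta>))) * (\<beta> * \<tau> powr (1 - \<alpha>))
      = fractional_integral \<alpha> f' \<tau>"
  proof -
    have "\<beta> * ((1 - \<alpha>) * \<tau> powr (1 - \<alpha> - 1)) * (\<beta> * \<tau>) = \<beta> * \<tau> powr (1 - \<alpha>)"
      using \<tau> \<beta>(2) by (simp add: powr_diff powr_minus_divide mult.assoc [symmetric])
    then have "(\<beta> * ((1 - \<alpha>) * \<tau> powr (1 - \<alpha> - 1))) * ?I f \<tau>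
        = \<beta> * \<tau> powr (1 - \<alpha>) * integral {0..1} (\<lambda>w. w powr \<beta> * f' (\<tau> * (1 - w powr \<beta>)))"
      unfolding parts by (simp only: mult.assoc [symmetric])
    moreover have "fractional_integral \<alpha> f' \<tau> = \<beta> * \<tau> powr (1 - \<alpha>) * ?I f' \<tau>"
      by (rule FI [OF f']) (use \<tau> in auto)
    ultimately show ?thesis unfolding split by (simp add: algebra_simps)
  qed
  ultimately have "((\<lambda>\<sigma>. \<beta> * (\<sigma> powr (1 - \<alpha>)) * ?I f \<sigma>) has_real_derivative fractional_integral \<alpha> f' \<tau>) (at \<tau>)"
    by simp
  then show ?thesis
    by (rule has_field_derivative_transform_within_open [of _ _ _ ?U]) (use \<tau> FI [OF f] in auto)
qed

section \<open>The midpoint sum with singular kernel\<close>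

text \<open>This is \<open>midpoint_power_sum\<close> for \<sigma> = \<alpha> - j, multiplied by
  h^(1+j-\<alpha>) and rewritten with N = t/h. The rate q = 3 - j stays below \<sigma> + 3 by
  exactly \<alpha> and scales to h^(4-\<alpha>) for every j.\<close>

lemma scaled_midpoint_power_sum:
  fixes \<alpha> t :: real and j :: nat
  assumes \<alpha>: "0 < \<alpha>" "\<alpha> < 1" and t: "0 < t" and j: "j \<le> 2"
  shows "(\<lambda>n. (t / real n) powr (1 + real j - \<alpha>) * (\<Sum>k<n. (real k + 1/2) powr (real j - \<alpha>))
      - (t powr (1 + real j - \<alpha>) / (1 + real j - \<alpha>)
         + (2 powr (\<alpha> - real j) - 1) * zeta_real (\<alpha> - real j) * (t / real n) powr (1 + real j - \<alpha>)
         + (\<alpha> - real j) / 24 * (t / real n)\<^sup>2 * t powr (real j - \<alpha> - 1)))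
    \<in> O(\<lambda>n. (t / real n) powr (4 - \<alpha>))"
proof -
  define \<sigma> q p where "\<sigma> = \<alpha> - real j" and "q = 3 - real j" and "p = 1 + real j - \<alpha>"
  have \<sigma>: "\<sigma> > - 3" "\<sigma> \<noteq> 1" "0 \<le> q" "q < \<sigma> + 3" using \<alpha> j by (auto simp: \<sigma>_def q_def)
  let ?X = "\<lambda>N. (\<Sum>k<N. (real k + 1/2) powr (- \<sigma>))
      - (real N powr (1 - \<sigma>) / (1 - \<sigma>) + (2 powr \<sigma> - 1) * zeta_real \<sigma> + \<sigma> / 24 * real N powr (- \<sigma> - 1))"
  obtain c where c: "c > 0" "\<forall>\<^sub>F N in sequentially. norm (?X N) \<le> c * norm (real N powr (- q))"
    using landau_o.bigE [OF midpoint_power_sum [OF \<sigma>]] by blast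
  show ?thesis
  proof (rule bigoI [of _ "c * t powr (- q)"], rule eventually_mono [OF eventually_conj [OF c(2) eventually_gt_at_top [of 0]]])
    fix n assume n: "norm (?X n) \<le> c * norm (real n powr (- q)) \<and> 0 < n"
    define h where "h = t / real n"
    have h: "h > 0" using n t by (simp add: h_def)
    have npow: "real n powr r = t powr r * h powr (- r)" for r
      using n t by (simp add: h_def powr_divide powr_minus field_simps)
    have hh: "h powr p * (t powr r * h powr (- r)) = t powr r * h powr (p - r)" for r
      by (simp add: powr_diff powr_minus field_simps)
    have e: "1 - \<sigma> = p" "- \<sigma> = real j - \<alpha>" "- \<sigma> - 1 = real j - \<alpha> - 1" by (simp_all add: \<sigma>_def p_def)
    have h2: "h powr 2 = h\<^sup>2" using h by simp
    have "h powr p * ?X n = h powr p * (\<Sum>k<n. (real k + 1/2) powr (real j - \<alpha>))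
        - (t powr p / p + (2 powr \<sigma> - 1) * zeta_real \<sigma> * h powr p + \<sigma> / 24 * h\<^sup>2 * t powr (real j - \<alpha> - 1))"
    proof -
      have 1: "h powr p * real n powr (1 - \<sigma>) = t powr p"
        using hh [of p] h unfolding npow e by simp
      have 2: "h powr p * real n powr (- \<sigma> - 1) = t powr (real j - \<alpha> - 1) * h\<^sup>2"
        using hh [of "real j - \<alpha> - 1"] unfolding npow e h2 [symmetric] by (simp add: p_def)
      have "h powr p * ?X n = h powr p * (\<Sum>k<n. (real k + 1/2) powr (- \<sigma>))
        - ((h powr p * real n powr (1 - \<sigma>)) / (1 - \<sigma>) + (2 powr \<sigma> - 1) * zeta_real \<sigma> * h powr p
           + \<sigma> / 24 * (h powr p * real n powr (- \<sigma> - 1)))"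
        by (simp add: algebra_simps)
      then show ?thesis unfolding 1 2 unfolding e by (simp add: algebra_simps)
    qed
    moreover have "norm (h powr p * ?X n) \<le> c * t powr (- q) * h powr (4 - \<alpha>)"
    proof -
      have "norm (h powr p * ?X n) \<le> h powr p * (c * norm (real n powr (- q)))"
        unfolding norm_mult using n by (intro mult_mono) auto
      also have "\<dots> = c * (h powr p * (t powr (- q) * h powr (- (- q))))"
        unfolding npow by (simp add: mult_ac)
      also have "\<dots> = c * t powr (- q) * h powr (4 - \<alpha>)"
        unfolding hh by (simp add: p_def q_def)
      finally show ?thesis .
    qed
    ultimately show "norm ((t / real n) powr (1 + real j - \<alpha>) * (\<Sum>k<n. (real k + 1/2) powr (real j - \<alpha>))
      - (t powr (1 + real j - \<alpha>) / (1 + real j - \<alpha>)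
         + (2 powr (\<alpha> - real j) - 1) * zeta_real (\<alpha> - real j) * (t / real n) powr (1 + real j - \<alpha>)
         + (\<alpha> - real j) / 24 * (t / real n)\<^sup>2 * t powr (real j - \<alpha> - 1)))
      \<le> c * t powr (- q) * norm ((t / real n) powr (4 - \<alpha>))"
      unfolding h_def [symmetric] p_def [symmetric] \<sigma>_def [symmetric] by simp
  qed
qed

lemma power_O_powr:
  fixes t a :: real
  assumes "0 < t" "a \<le> real m"
  shows "(\<lambda>n. (t / real n) ^ m) \<in> O(\<lambda>n. (t / real n) powr a)"
proof (rule bigoI [of _ "t powr (real m - a)"], rule eventually_mono [OF eventually_gt_at_top [of 0]])
  fix n :: nat assume "0 < n"
  then have h: "0 < t / real n" "t / real n \<le> t" using assms by (auto simp: field_simps)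
  have "(t / real n) ^ m = (t / real n) powr (real m - a) * (t / real n) powr a"
    using h by (simp flip: powr_add powr_realpow)
  also have "\<dots> \<le> t powr (real m - a) * (t / real n) powr a"
    using h assms by (intro mult_right_mono powr_mono2) auto
  finally show "norm ((t / real n) ^ m) \<le> t powr (real m - a) * norm ((t / real n) powr a)"
    using h by simp
qed

text \<open>The values \<open>v 1 t\<close> and \<open>v 2 t\<close> enter the boundary term of order \<open>h\<^sup>2\<close> at the regular end of the interval.\<close>
theorem midpoint_kernel_sum:
  fixes v :: "nat \<Rightarrow> real \<Rightarrow> real"
  assumes \<alpha>: "0 < \<alpha>" "\<alpha> < 1" and t: "0 < t"
    and der: "\<And>i x. x \<in> {0..t} \<Longrightarrow> i \<le> 4 \<Longrightarrow> (v i has_real_derivative v (Suc i) x) (at x within {0..t})"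
    and cont: "continuous_on {0..t} (v 5)"
    and v0: "v 0 0 = 0" and vt: "v 1 t = 0" "v 2 t = 0"
  defines "H \<equiv> \<lambda>\<sigma>. (2 powr \<sigma> - 1) * zeta_real \<sigma>"
  shows "(\<lambda>n. (\<Sum>k<n. ((real k + 1/2) * (t / real n)) powr (- \<alpha>)
          * (v 0 (real (Suc k) * (t / real n)) - v 0 (real k * (t / real n))))
      - (integral {0..t} (\<lambda>u. v 1 u * u powr (- \<alpha>))
         + H \<alpha> * v 1 0 * (t / real n) powr (1 - \<alpha>)
         + H (\<alpha> - 1) * v 2 0 * (t / real n) powr (2 - \<alpha>)
         + (t / real n)\<^sup>2 / 24 * integral {0..t} (\<lambda>u. v 3 u * u powr (- \<alpha>))
         + (H (\<alpha> - 2) / 2 + H \<alpha> / 24) * v 3 0 * (t / real n) powr (3 - \<alpha>)))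
    \<in> O(\<lambda>n. (t / real n) powr (4 - \<alpha>))"
proof -
  define g0 g1 g2 where "g0 = v 1 0" and "g1 = v 2 0" and "g2 = v 3 0"
  \<comment> \<open>\<open>P 0\<close> is the cubic Taylor polynomial of v at 0, which has no
    constant term since \<open>v 0 0 = 0\<close>; \<open>P i\<close> is its i-th derivative.\<close>
  define P where "P i u = (if i = 0 then g0 * u + g1 * u\<^sup>2 / 2 + g2 * u ^ 3 / 6
      else if i = 1 then g0 + g1 * u + g2 * u\<^sup>2 / 2
      else if i = 2 then g1 + g2 * u else if i = 3 then g2 else 0)" for i :: nat and u :: real
  define W where "W i u = v i u - P i u" for i u
  have derP: "(P i has_real_derivative P (Suc i) x) (at x within S)" if i: "i \<le> 4" for i x S
  proof -
    consider "i = 0" | "i = 1" | "i = 2" | "i = 3" | "i = 4" using i by linarith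
    then show ?thesis
      by cases (unfold P_def, auto intro!: derivative_eq_intros simp: eval_nat_numeral)
  qed
  have derW: "(W i has_real_derivative W (Suc i) x) (at x within {0..t})" if "x \<in> {0..t}" "i \<le> 4" for i x
    unfolding W_def using DERIV_diff [OF der [OF that] derP [OF that(2)]] by simp
  have contv: "continuous_on {0..t} (v i)" if "i \<le> 5" for i
  proof (cases "i = 5")
    case False
    with that have "i \<le> 4" by simp
    then show ?thesis by (intro DERIV_continuous_on [OF der]) auto
  qed (use cont in simp)
  have "compact (v i ` {0..t})" if "i \<le> 5" for i
    by (rule compact_continuous_image [OF contv [OF that]]) simp
  then have bdd: "bounded (v 4 ` {0..t} \<union> v 5 ` {0..t})"
    by (simp add: compact_imp_bounded)
  then obtain B where B: "B > 0" "\<forall>z \<in> v 4 ` {0..t} \<union> v 5 ` {0..t}. norm z \<le> B"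
    using bounded_pos by metis
  \<comment> \<open>\<open>B\<close> alone serves the orders up to 4. At order 5 the target is M/u,
    and B \<le> M/u for u \<le> t needs B t \<le> M.\<close>
  define M where "M = B * (1 + t)"
  have M: "B \<le> M" "B * t \<le> M" using B t by (auto simp: M_def algebra_simps)
  have W45: "\<bar>W 4 u\<bar> \<le> B" "\<bar>W 5 u\<bar> \<le> B" if "u \<in> {0..t}" for u
    using B that by (auto simp: W_def P_def)
  have Wz: "W i 0 = 0" if i: "i \<le> 3" for i
  proof -
    consider "i = 0" | "i = 1" | "i = 2" | "i = 3" using i by linarith
    then show ?thesis by cases (auto simp: W_def P_def v0 g0_def g1_def g2_def)
  qed
  have bdW: "\<bar>W i u\<bar> \<le> M * u powr (4 - real i)" if u: "u \<in> {0<..t}" and i: "i \<le> 5" for i u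
  proof -
    consider "i \<le> 3" | "i = 4" | "i = 5" using i by linarith
    then show ?thesis
    proof cases
      case 1
      have "norm (W (i + 0) u - (\<Sum>j\<le>3 - i. W (i + j) 0 * (u - 0) ^ j / fact j))
          \<le> B * norm (u - 0) ^ Suc (3 - i) / fact (3 - i)"
      proof (rule field_Taylor [of "{0..t}" "3 - i" "\<lambda>j. W (i + j)"])
        fix j x assume "x \<in> {0..t}" "j \<le> 3 - i"
        then show "(W (i + j) has_real_derivative W (i + Suc j) x) (at x within {0..t})"
          using derW [of x "i + j"] 1 by simp
      next
        fix x assume "x \<in> {0..t}"
        moreover have "i + Suc (3 - i) = 4" using 1 by simp
        ultimately show "norm (W (i + Suc (3 - i)) x) \<le> B" using W45 by simp
      qed (use u in auto)
      moreover have "(\<Sum>j\<le>3 - i. W (i + j) 0 * (u - 0) ^ j / fact j) = 0"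
        by (rule sum.neutral) (use 1 Wz in auto)
      moreover have "Suc (3 - i) = 4 - i" using 1 by simp
      ultimately have "\<bar>W i u\<bar> \<le> B * u ^ (4 - i) / fact (3 - i)"
        using u by (simp del: power_Suc)
      also have "\<dots> \<le> B * u ^ (4 - i) / 1"
        using B u by (intro divide_left_mono) (auto simp: fact_ge_1)
      also have "\<dots> = B * u powr (4 - real i)"
        using u 1 by (simp flip: powr_realpow add: of_nat_diff)
      also have "\<dots> \<le> M * u powr (4 - real i)" using M by (intro mult_right_mono) auto
      finally show ?thesis .
    next
      case 2
      then show ?thesis using W45 [of u] u M by simp
    next
      case 3
      have "\<bar>W 5 u\<bar> \<le> B" using W45 [of u] u by simp
      also have "\<dots> = B * u * u powr (- 1)" using u by simp
      also have "\<dots> \<le> M * u powr (- 1)"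
      proof (rule mult_right_mono)
        have "B * u \<le> B * t" using B u by simp
        then show "B * u \<le> M" using M by simp
      qed simp
      finally show ?thesis using 3 by simp
    qed
  qed
  have hv: "((\<lambda>u. v i u * u powr (- \<alpha>)) has_integral integral {0..t} (\<lambda>u. v i u * u powr (- \<alpha>))) {0..t}" if "i \<le> 5" for i
    using fractional_integral_substitution [OF \<alpha> t contv [OF that]] by (auto simp: integral_unique)
  have hpow: "((\<lambda>u. u powr (real j - \<alpha>)) has_integral t powr (1 + real j - \<alpha>) / (1 + real j - \<alpha>)) {0..t}" for j
    using has_integral_powr_from_0 [of "real j - \<alpha>" t] \<alpha> t by (simp add: algebra_simps)
  define i0 i1 i2 where "i0 = t powr (1 - \<alpha>) / (1 - \<alpha>)" and "i1 = t powr (2 - \<alpha>) / (2 - \<alpha>)"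
    and "i2 = t powr (3 - \<alpha>) / (3 - \<alpha>)"
  have hp: "((\<lambda>u. u powr (- \<alpha>)) has_integral i0) {0..t}"
    "((\<lambda>u. u powr (1 - \<alpha>)) has_integral i1) {0..t}"
    "((\<lambda>u. u powr (2 - \<alpha>)) has_integral i2) {0..t}"
    using hpow [of 0] hpow [of 1] hpow [of 2] by (auto simp: i0_def i1_def i2_def)
  have hP1: "((\<lambda>u. P 1 u * u powr (- \<alpha>)) has_integral (g0 * i0 + g1 * i1 + g2 / 2 * i2)) {0..t}"
  proof -
    have "((\<lambda>u. g0 * u powr (- \<alpha>) + g1 * u powr (1 - \<alpha>) + g2 / 2 * u powr (2 - \<alpha>))
        has_integral (g0 * i0 + g1 * i1 + g2 / 2 * i2)) {0..t}"
      by (intro has_integral_add has_integral_mult_right hp)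
    then show ?thesis
    proof (rule has_integral_eq [rotated])
      fix u assume u: "u \<in> {0..t}"
      show "g0 * u powr (- \<alpha>) + g1 * u powr (1 - \<alpha>) + g2 / 2 * u powr (2 - \<alpha>) = P 1 u * u powr (- \<alpha>)"
      proof (cases "u = 0")
        case False
        then have "u powr (1 - \<alpha>) = u * u powr (- \<alpha>)" "u powr (2 - \<alpha>) = u\<^sup>2 * u powr (- \<alpha>)"
          using u by (simp_all add: powr_diff powr_minus divide_inverse)
        then show ?thesis by (simp add: P_def algebra_simps)
      qed simp
    qed
  qed
  have hP3: "((\<lambda>u. P 3 u * u powr (- \<alpha>)) has_integral g2 * i0) {0..t}"
    unfolding P_def using has_integral_mult_right [OF hp(1), of g2] by simp
  define I1 I3 where "I1 = integral {0..t} (\<lambda>u. v 1 u * u powr (- \<alpha>))"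
    and "I3 = integral {0..t} (\<lambda>u. v 3 u * u powr (- \<alpha>))"
  have hW1: "((\<lambda>u. W 1 u * frac_kernel \<alpha> 0 u) has_integral (I1 - (g0 * i0 + g1 * i1 + g2 / 2 * i2))) {0..t}"
    unfolding frac_kernel_0 W_def left_diff_distrib I1_def using hv [of 1] by (intro has_integral_diff hP1) auto
  have hW3: "((\<lambda>u. W 3 u * frac_kernel \<alpha> 0 u) has_integral (I3 - g2 * i0)) {0..t}"
    unfolding frac_kernel_0 W_def left_diff_distrib I3_def using hv [of 3] by (intro has_integral_diff hP3) auto
  define h where "h n = t / real n" for n
  define e0 e1 e2 where "e0 = t powr (- \<alpha> - 1)" and "e1 = t powr (- \<alpha>)" and "e2 = t powr (1 - \<alpha>)"
  have ee: "e1 = t * e0" "e2 = t\<^sup>2 * e0"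
    using t by (simp_all add: e0_def e1_def e2_def powr_diff powr_minus power2_eq_square field_simps)
  \<comment> \<open>Since v' and v'' vanish at \<open>t\<close>, the boundary term of
    \<open>W\<close> is minus that of \<open>P\<close>. Divided by 24 it is the combination, with
    weights g0, g1 and g2/2, of the h^2 terms in the power sums for j = 0, 1, 2, and this makes the
    two cancel.\<close>
  define D where "D = \<alpha> * g0 * e0 + (\<alpha> - 1) * g1 * e1 + (\<alpha> / 2 - 1) * g2 * e2"
  have bdry: "W 2 t * frac_kernel \<alpha> 0 t + W 1 t * frac_kernel \<alpha> 1 t = D"
    unfolding One_nat_def frac_kernel_0 frac_kernel_1 e0_def [symmetric] e1_def [symmetric] D_def
    using vt by (simp add: W_def P_def ee algebra_simps power2_eq_square)
  define RW where "RW n = (\<Sum>k<n. frac_kernel \<alpha> 0 ((real k + 1/2) * h n) * (W 0 (real (Suc k) * h n) - W 0 (real k * h n)))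
      - (I1 - (g0 * i0 + g1 * i1 + g2 / 2 * i2) + (h n)\<^sup>2 / 24 * (I3 - g2 * i0) - (h n)\<^sup>2 / 24 * D)" for n
  have RW: "RW \<in> O(\<lambda>n. h n powr (4 - \<alpha>))"
    using midpoint_kernel_sum_flat [OF \<alpha> t derW bdW Wz [of 0] has_integral_integrable [OF hW1] has_integral_integrable [OF hW3]]
    unfolding RW_def [abs_def] h_def bdry integral_unique [OF hW1] integral_unique [OF hW3] by simp
  define S where "S j n = h n powr (1 + real j - \<alpha>) * (\<Sum>k<n. (real k + 1/2) powr (real j - \<alpha>))" for j n
  define R0 where "R0 n = S 0 n - (i0 + H \<alpha> * h n powr (1 - \<alpha>) + \<alpha> / 24 * (h n)\<^sup>2 * e0)" for n
  define R1 where "R1 n = S 1 n - (i1 + H (\<alpha> - 1) * h n powr (2 - \<alpha>) + (\<alpha> - 1) / 24 * (h n)\<^sup>2 * e1)" for n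
  define R2 where "R2 n = S 2 n - (i2 + H (\<alpha> - 2) * h n powr (3 - \<alpha>) + (\<alpha> - 2) / 24 * (h n)\<^sup>2 * e2)" for n
  have R: "R0 \<in> O(\<lambda>n. h n powr (4 - \<alpha>))" "R1 \<in> O(\<lambda>n. h n powr (4 - \<alpha>))" "R2 \<in> O(\<lambda>n. h n powr (4 - \<alpha>))"
    using scaled_midpoint_power_sum [OF \<alpha> t, of 0] scaled_midpoint_power_sum [OF \<alpha> t, of 1] scaled_midpoint_power_sum [OF \<alpha> t, of 2]
    unfolding R0_def [abs_def] R1_def [abs_def] R2_def [abs_def] S_def h_def H_def i0_def i1_def i2_def e0_def e1_def e2_def
    by simp_all
  \<comment> \<open>The last summand, with 576 = 24^2, is the h^2 term of \<open>S 0\<close>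
    multiplied by the prefactor g2 h^2 / 24 of its second occurrence.\<close>
  define RP where "RP n = g0 * R0 n + g1 * R1 n + g2 / 2 * R2 n + g2 / 24 * ((h n)\<^sup>2 * R0 n) + g2 * \<alpha> / 576 * e0 * (h n) ^ 4" for n
  have RP: "RP \<in> O(\<lambda>n. h n powr (4 - \<alpha>))"
  proof -
    have "(\<lambda>n. (h n)\<^sup>2) \<in> O(\<lambda>n. h n powr 0)"
      unfolding h_def by (rule power_O_powr [OF t]) simp
    then have "(\<lambda>n. (h n)\<^sup>2 * R0 n) \<in> O(\<lambda>n. h n powr 0 * h n powr (4 - \<alpha>))"
      by (rule landau_o.big.mult [OF _ R(1)])
    then have "(\<lambda>n. (h n)\<^sup>2 * R0 n) \<in> O(\<lambda>n. h n powr (4 - \<alpha>))"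
      by (simp only: powr_add [symmetric]) simp
    moreover have "(\<lambda>n. h n ^ 4) \<in> O(\<lambda>n. h n powr (4 - \<alpha>))"
      unfolding h_def by (rule power_O_powr [OF t]) (use \<alpha> in simp)
    moreover have "(\<lambda>n. c * f n) \<in> O(g)" if "f \<in> O(g)" for c :: real and f g :: "nat \<Rightarrow> real"
      using that by (cases "c = 0") simp_all
    ultimately show ?thesis
      unfolding RP_def [abs_def] using R by (intro sum_in_bigo(1))
  qed
  \<comment> \<open>With x = k + 1/2 one has ((x + 1/2)^3 - (x - 1/2)^3)/6 = x^2/2 + 1/24. The
    constant 1/24 brings \<open>S 0\<close> in a second time and so puts \<zeta>(\<alpha>) into the
    coefficient of y'''.\<close>
  have sumP: "(\<Sum>k<n. ((real k + 1/2) * h n) powr (- \<alpha>) * (P 0 (real (Suc k) * h n) - P 0 (real k * h n)))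
      = g0 * S 0 n + g1 * S 1 n + g2 / 2 * S 2 n + g2 / 24 * (h n)\<^sup>2 * S 0 n" if n: "n > 0" for n
  proof -
    let ?h = "h n"
    have h: "?h > 0" using t n by (simp add: h_def)
    have "((real k + 1/2) * ?h) powr (- \<alpha>) * (P 0 (real (Suc k) * ?h) - P 0 (real k * ?h))
      = g0 * (?h powr (1 - \<alpha>) * (real k + 1/2) powr (- \<alpha>))
        + g1 * (?h powr (2 - \<alpha>) * (real k + 1/2) powr (1 - \<alpha>))
        + g2 / 2 * (?h powr (3 - \<alpha>) * (real k + 1/2) powr (2 - \<alpha>))
        + g2 / 24 * ?h\<^sup>2 * (?h powr (1 - \<alpha>) * (real k + 1/2) powr (- \<alpha>))" for k
    proof -
      define x where "x = real k + 1/2"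
      have x: "x > 0" by (simp add: x_def)
      have k: "real (Suc k) = x + 1/2" "real k = x - 1/2" by (simp_all add: x_def)
      have pw: "z powr (1 - \<alpha>) = z * z powr (- \<alpha>)" "z powr (2 - \<alpha>) = z\<^sup>2 * z powr (- \<alpha>)"
        "z powr (3 - \<alpha>) = z ^ 3 * z powr (- \<alpha>)" if "z > 0" for z :: real
        using that by (simp_all add: powr_diff powr_minus divide_inverse)
      have "(x * ?h) powr (- \<alpha>) = x powr (- \<alpha>) * ?h powr (- \<alpha>)"
        using x h by (simp add: powr_mult)
      moreover have "P 0 ((x + 1/2) * ?h) - P 0 ((x - 1/2) * ?h)
          = g0 * ?h + g1 * ?h\<^sup>2 * x + g2 / 2 * ?h ^ 3 * x\<^sup>2 + g2 / 24 * ?h ^ 3"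
        by (simp add: P_def field_simps power2_eq_square power3_eq_cube)
      ultimately show ?thesis
        unfolding x_def [symmetric] unfolding k pw [OF x] pw [OF h]
        by (simp add: algebra_simps power2_eq_square power3_eq_cube)
    qed
    then show ?thesis
      by (simp add: S_def sum.distrib sum_distrib_left)
  qed
  have "(\<Sum>k<n. ((real k + 1/2) * h n) powr (- \<alpha>) * (v 0 (real (Suc k) * h n) - v 0 (real k * h n)))
      - (I1 + H \<alpha> * g0 * h n powr (1 - \<alpha>) + H (\<alpha> - 1) * g1 * h n powr (2 - \<alpha>) + (h n)\<^sup>2 / 24 * I3
         + (H (\<alpha> - 2) / 2 + H \<alpha> / 24) * g2 * h n powr (3 - \<alpha>)) = RW n + RP n" if n: "n > 0" for n
  proof -
    have h3: "h n powr (3 - \<alpha>) = (h n)\<^sup>2 * h n powr (1 - \<alpha>)"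
    proof -
      have "h n > 0" using t n by (simp add: h_def)
      then have "(h n)\<^sup>2 * h n powr (1 - \<alpha>) = h n powr 2 * h n powr (1 - \<alpha>)" by simp
      then show ?thesis by (simp only: powr_add [symmetric]) simp
    qed
    have "(\<Sum>k<n. ((real k + 1/2) * h n) powr (- \<alpha>) * (v 0 (real (Suc k) * h n) - v 0 (real k * h n)))
      = (\<Sum>k<n. frac_kernel \<alpha> 0 ((real k + 1/2) * h n) * (W 0 (real (Suc k) * h n) - W 0 (real k * h n)))
        + (\<Sum>k<n. ((real k + 1/2) * h n) powr (- \<alpha>) * (P 0 (real (Suc k) * h n) - P 0 (real k * h n)))"
      unfolding sum.distrib [symmetric] frac_kernel_0 W_def by (intro sum.cong) (auto simp: algebra_simps)
    then show ?thesis
      unfolding sumP [OF n] RW_def RP_def R0_def R1_def R2_def D_def h3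
      by (simp add: field_simps power2_eq_square power4_eq_xxxx)
  qed
  moreover have "(\<lambda>n. RW n + RP n) \<in> O(\<lambda>n. h n powr (4 - \<alpha>))"
    by (rule sum_in_bigo(1) [OF RW RP])
  ultimately have "(\<lambda>n. (\<Sum>k<n. ((real k + 1/2) * h n) powr (- \<alpha>) * (v 0 (real (Suc k) * h n) - v 0 (real k * h n)))
      - (I1 + H \<alpha> * g0 * h n powr (1 - \<alpha>) + H (\<alpha> - 1) * g1 * h n powr (2 - \<alpha>) + (h n)\<^sup>2 / 24 * I3
         + (H (\<alpha> - 2) / 2 + H \<alpha> / 24) * g2 * h n powr (3 - \<alpha>))) \<in> O(\<lambda>n. h n powr (4 - \<alpha>))"
    by (subst landau_o.big.in_cong [where g = "\<lambda>n. RW n + RP n"])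
      (auto intro: eventually_mono [OF eventually_gt_at_top [of 0]])
  then show ?thesis
    unfolding h_def I1_def I3_def g0_def g1_def g2_def .
qed

section \<open>The Caputo derivative\<close>

text \<open>With b(k) = (k + 1/2)^(-\<alpha>) = 2^\<alpha>/(2k + 1)^\<alpha> the weights are b(k) -
  b(k - 1), where b(-1) and b(n) are replaced by 0; the claim is then summation by parts.\<close>

lemma sum_weight:
  assumes n: "n > 0"
  shows "(\<Sum>k=0..n. weight \<alpha> n k * Y k) = (\<Sum>k<n. (real k + 1/2) powr (- \<alpha>) * (Y k - Y (Suc k)))"
proof -
  define b where "b k = (real k + 1/2) powr (- \<alpha>)" for k :: nat
  have b: "b k = 2 powr \<alpha> / (2 * real k + 1) powr \<alpha>" for k
  proof -
    have "real k + 1/2 = (2 * real k + 1) / 2" by simp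
    then have "b k = (2 * real k + 1) powr (- \<alpha>) / 2 powr (- \<alpha>)"
      unfolding b_def by (simp only: powr_divide)
    then show ?thesis by (simp add: powr_minus field_simps)
  qed
  have w: "weight \<alpha> n k = (if k < n then b k else 0) - (if k = 0 then 0 else b (k - 1))" if "k \<le> n" for k
  proof (cases k)
    case 0
    then show ?thesis using n by (simp add: weight_def b)
  next
    case (Suc j)
    then show ?thesis using that n by (auto simp: weight_def b algebra_simps)
  qed
  have "(\<Sum>k=0..n. weight \<alpha> n k * Y k)
      = (\<Sum>k=0..n. (if k < n then b k else 0) * Y k) - (\<Sum>k=0..n. (if k = 0 then 0 else b (k - 1)) * Y k)"
    unfolding sum_subtractf [symmetric] by (intro sum.cong) (auto simp: w left_diff_distrib)
  also have "(\<Sum>k=0..n. (if k < n then b k else 0) * Y k) = (\<Sum>k<n. b k * Y k)"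
    by (intro sum.mono_neutral_cong_right) auto
  also have "(\<Sum>k=0..n. (if k = 0 then 0 else b (k - 1)) * Y k) = (\<Sum>k<n. b k * Y (Suc k))"
    by (simp add: sum.atLeast0_atMost_Suc_shift sum.atLeast_Suc_atMost atLeast0AtMost
        sum.atMost_shift del: sum.atMost_Suc)
  finally show ?thesis by (simp add: b_def sum_subtractf right_diff_distrib)
qed

section \<open>Iterated derivatives on a closed interval and their link with the Caputo
  derivative\<close>

declare nderiv.simps(2) [simp del]

lemma nderiv_has_derivative:
  assumes "C_diff_on k S f" "j < k" "x \<in> S"
  shows "(nderiv j S f has_real_derivative nderiv (Suc j) S f x) (at x within S)"
  using assms vector_derivative_works [of "nderiv j S f" "at x within S"]
  by (auto simp: nderiv.simps(2) C_diff_on_def differentiable_on_def has_real_derivative_iff_has_vector_derivative)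

lemma nderiv_continuous:
  assumes "C_diff_on k S f" "j \<le> k"
  shows "continuous_on S (nderiv j S f)"
  using assms DERIV_continuous_on [OF nderiv_has_derivative [OF assms(1)]]
  by (cases "j = k") (auto simp: C_diff_on_def)

lemma C_diff_on_mono:
  assumes "C_diff_on k S f" "j \<le> k"
  shows "C_diff_on j S f"
  using assms nderiv_continuous [OF assms] unfolding C_diff_on_def by auto

text \<open>\<open>caputo\<close> uses the two-sided \<open>deriv\<close>, whereas regularity is
  given relative to {0..T}. The two derivatives agree at interior points, and \<tau> < T leaves only
  the end points 0 and \<tau> as possible exceptions, a null set. The reflection x = \<tau> - u does
  the rest.\<close>

lemma caputo_eq_fractional_integral:
  assumes \<alpha>: "0 < \<alpha>" "\<alpha> < 1" and \<tau>: "0 < \<tau>" "\<tau> < T" and y: "C_diff_on 1 {0..T} y"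
  shows "caputo \<alpha> y \<tau> = fractional_integral \<alpha> (nderiv 1 {0..T} y) \<tau> / Gamma (1 - \<alpha>)"
proof -
  let ?y' = "nderiv 1 {0..T} y"
  have "continuous_on {0..T} ?y'" by (rule nderiv_continuous [OF y]) simp
  then have "continuous_on {0..\<tau>} (\<lambda>u. ?y' (\<tau> - u))"
    by (rule continuous_on_compose2) (use \<tau> in \<open>auto intro!: continuous_intros\<close>)
  from fractional_integral_substitution [OF \<alpha> \<tau>(1) this]
  have "((\<lambda>u. ?y' (\<tau> - u) * u powr (- \<alpha>)) has_integral fractional_integral \<alpha> ?y' \<tau>) {0..\<tau>}"
    unfolding fractional_integral_def by (simp add: integral_unique)
  from has_integral_reflect_right [OF this]
  have "((\<lambda>x. ?y' x * (\<tau> - x) powr (- \<alpha>)) has_integral fractional_integral \<alpha> ?y' \<tau>) {0..\<tau>}"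
    by simp
  then have "((\<lambda>x. deriv y x / (\<tau> - x) powr \<alpha>) has_integral fractional_integral \<alpha> ?y' \<tau>) {0..\<tau>}"
  proof (rule has_integral_spike [rotated 2])
    show "negligible {0, \<tau>}" by simp
    fix x assume "x \<in> {0..\<tau>} - {0, \<tau>}"
    then have x: "0 < x" "x < T" using \<tau> by auto
    then have "(y has_real_derivative ?y' x) (at x)"
      using nderiv_has_derivative [OF y, of 0 x] by (simp add: at_within_Icc_at)
    then show "deriv y x / (\<tau> - x) powr \<alpha> = ?y' x * (\<tau> - x) powr (- \<alpha>)"
      by (simp add: DERIV_imp_deriv powr_minus divide_inverse)
  qed
  then show ?thesis
    by (simp add: caputo_def integral_unique)
qed

text \<open>Each differentiation moves onto the function at the price of a boundary value at 0:
  y'(0) = 0 pays for the first step, y''(0) = 0 for the second.\<close>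

lemma caputo_second_derivative:
  assumes \<alpha>: "0 < \<alpha>" "\<alpha> < 1" and t: "0 < t" "t < T" and y: "C_diff_on 3 {0..T} y"
    and y0: "nderiv 1 {0..T} y 0 = 0" "nderiv 2 {0..T} y 0 = 0"
  shows "(deriv ^^ 2) (caputo \<alpha> y) t = fractional_integral \<alpha> (nderiv 3 {0..T} y) t / Gamma (1 - \<alpha>)"
proof -
  let ?Y = "\<lambda>j. nderiv j {0..T} y"
  let ?J = "\<lambda>j \<tau>. fractional_integral \<alpha> (?Y j) \<tau> / Gamma (1 - \<alpha>)"
  have dJ: "(?J j has_real_derivative ?J (Suc j) \<tau>) (at \<tau>)" if "0 < \<tau>" "\<tau> < T" "j < 3" "?Y j 0 = 0" for j \<tau>
    by (rule DERIV_cdivide, rule fractional_integral_has_derivative [OF \<alpha> that(1,2)])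
      (use that nderiv_has_derivative [OF y] nderiv_continuous [OF y] in auto)
  have y1: "C_diff_on 1 {0..T} y"
    by (rule C_diff_on_mono [OF y]) simp
  \<comment> \<open>Needed on a whole neighbourhood of \<open>t\<close>, since the identity is
    differentiated once more.\<close>
  have 1: "deriv (caputo \<alpha> y) \<tau> = ?J 2 \<tau>" if "0 < \<tau>" "\<tau> < T" for \<tau>
  proof (rule DERIV_imp_deriv)
    have "(?J 1 has_real_derivative ?J 2 \<tau>) (at \<tau>)"
      using dJ [OF that, of 1] y0 by (simp add: numeral_2_eq_2)
    then show "(caputo \<alpha> y has_real_derivative ?J 2 \<tau>) (at \<tau>)"
      by (rule has_field_derivative_transform_within_open [of _ _ _ "{0<..<T}"])
        (use that caputo_eq_fractional_integral [OF \<alpha> _ _ y1] in auto)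
  qed
  have "deriv (deriv (caputo \<alpha> y)) t = ?J 3 t"
  proof (rule DERIV_imp_deriv)
    have "(?J 2 has_real_derivative ?J 3 t) (at t)"
      using dJ [OF t, of 2] y0 by (simp add: numeral_2_eq_2 numeral_3_eq_3)
    then show "(deriv (caputo \<alpha> y) has_real_derivative ?J 3 t) (at t)"
      by (rule has_field_derivative_transform_within_open [of _ _ _ "{0<..<T}"]) (use t 1 in auto)
  qed
  then show ?thesis by (simp add: numeral_2_eq_2)
qed

section \<open>The expansion of the weighted sum\<close>

theorem lemma1:
  fixes \<alpha> t T :: real and y :: "real \<Rightarrow> real"
  assumes "0 < \<alpha>" and "\<alpha> < 1"
    and "0 < t" and "t < T"
    and "C_diff_on 5 {0..T} y"
    and "y 0 = 0" and "nderiv 1 {0..T} y 0 = 0" and "nderiv 2 {0..T} y 0 = 0"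
  shows "(\<lambda>n::nat. let h = t / real n in
            1 / (Gamma (1 - \<alpha>) * h powr \<alpha>) * (\<Sum>k=0..n. weight \<alpha> n k * y (real (n - k) * h))
            - (caputo \<alpha> y t
               + 1 / Gamma (1 - \<alpha>) * (2 powr \<alpha> - 1) * zeta_real \<alpha>
                   * nderiv 1 {0..T} y t * h powr (1 - \<alpha>)
               - (2 powr (\<alpha> - 1) - 1) / Gamma (1 - \<alpha>) * zeta_real (\<alpha> - 1)
                   * nderiv 2 {0..T} y t * h powr (2 - \<alpha>)
               + 1 / 24 * (deriv ^^ 2) (caputo \<alpha> y) t * h ^ 2
               + 1 / Gamma (1 - \<alpha>)
                   * (1 / 24 * (2 powr \<alpha> - 1) * zeta_real \<alpha>
                      + 1 / 2 * (2 powr (\<alpha> - 2) - 1) * zeta_real (\<alpha> - 2))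
                   * nderiv 3 {0..T} y t * h powr (3 - \<alpha>)))
         \<in> O(\<lambda>n. (t / real n) powr (4 - \<alpha>))"
proof -
  note \<alpha> = assms(1,2) and t = assms(3,4) and y = assms(5)
  let ?Y = "\<lambda>j. nderiv j {0..T} y"
  define G where "G = Gamma (1 - \<alpha>)"
  have "Gamma (1 - \<alpha>) > 0" using \<alpha> by (intro Gamma_real_pos) simp
  then have G: "G \<noteq> 0" by (simp add: G_def)
  \<comment> \<open>The signs come from the chain rule for t - u. At u = 0 the derivatives are
    y'(t), -y''(t), y'''(t), the coefficients of the expansion; at u = t the first two reduce to
    y'(0) and -y''(0), which vanish.\<close>
  define v where "v i u = (if i = 0 then y t - y (t - u) else (- 1) ^ Suc i * ?Y i (t - u))" for i u
  have der: "(v i has_real_derivative v (Suc i) u) (at u within {0..t})" if u: "u \<in> {0..t}" and i: "i \<le> 4" for i u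
  proof -
    have "t - u \<in> {0..T}" "(\<lambda>u. t - u) ` {0..t} \<subseteq> {0..T}" using u t by auto
    then have "(?Y i has_real_derivative ?Y (Suc i) (t - u)) (at (t - u) within (\<lambda>u. t - u) ` {0..t})"
      by (intro DERIV_subset [OF nderiv_has_derivative [OF y]]) (use i in auto)
    moreover have "((\<lambda>u. t - u) has_real_derivative - 1) (at u within {0..t})"
      by (auto intro!: derivative_eq_intros)
    ultimately have d: "((\<lambda>u. ?Y i (t - u)) has_real_derivative ?Y (Suc i) (t - u) * - 1) (at u within {0..t})"
      by (rule DERIV_image_chain [unfolded o_def])
    show ?thesis
    proof (cases "i = 0")
      case True
      have "((\<lambda>u. y t - ?Y i (t - u)) has_real_derivative 0 - ?Y (Suc i) (t - u) * - 1) (at u within {0..t})"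
        by (intro DERIV_diff DERIV_const d)
      then show ?thesis using True by (simp add: v_def [abs_def])
    next
      case False
      then show ?thesis using DERIV_cmult [OF d, of "(- 1) ^ Suc i"] by (simp add: v_def [abs_def])
    qed
  qed
  have cont: "continuous_on {0..t} (v 5)"
  proof -
    have "continuous_on {0..t} (\<lambda>u. ?Y 5 (t - u))"
      by (rule continuous_on_compose2 [OF nderiv_continuous [OF y order.refl]])
        (use t in \<open>auto intro!: continuous_intros\<close>)
    then show ?thesis by (simp add: v_def [abs_def])
  qed
  have v0: "v 0 0 = 0" and vt: "v 1 t = 0" "v 2 t = 0"
    using assms(7,8) by (simp_all add: v_def)
  have C: "C_diff_on k {0..T} y" if "k \<le> 5" for k
    by (rule C_diff_on_mono [OF y that])
  have I1: "integral {0..t} (\<lambda>u. v 1 u * u powr (- \<alpha>)) = G * caputo \<alpha> y t"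
    using caputo_eq_fractional_integral [OF \<alpha> t C [of 1]] G
    by (simp add: v_def fractional_integral_def G_def)
  have I3: "integral {0..t} (\<lambda>u. v 3 u * u powr (- \<alpha>)) = G * (deriv ^^ 2) (caputo \<alpha> y) t"
    using caputo_second_derivative [OF \<alpha> t C [of 3] assms(7,8)] G
    by (simp add: v_def fractional_integral_def G_def)
  define E where "E n = (\<Sum>k<n. ((real k + 1/2) * (t / real n)) powr (- \<alpha>)
          * (v 0 (real (Suc k) * (t / real n)) - v 0 (real k * (t / real n))))
      - (G * caputo \<alpha> y t
         + (2 powr \<alpha> - 1) * zeta_real \<alpha> * v 1 0 * (t / real n) powr (1 - \<alpha>)
         + (2 powr (\<alpha> - 1) - 1) * zeta_real (\<alpha> - 1) * v 2 0 * (t / real n) powr (2 - \<alpha>)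
         + (t / real n)\<^sup>2 / 24 * (G * (deriv ^^ 2) (caputo \<alpha> y) t)
         + ((2 powr (\<alpha> - 2) - 1) * zeta_real (\<alpha> - 2) / 2 + (2 powr \<alpha> - 1) * zeta_real \<alpha> / 24) * v 3 0
             * (t / real n) powr (3 - \<alpha>))" for n
  have "E \<in> O(\<lambda>n. (t / real n) powr (4 - \<alpha>))"
    using midpoint_kernel_sum [OF \<alpha> t(1) der cont v0 vt] unfolding E_def [abs_def] I1 I3 .
  then have "(\<lambda>n. E n / G) \<in> O(\<lambda>n. (t / real n) powr (4 - \<alpha>))"
    using G by (simp add: landau_o.big.cdiv_in_iff')
  moreover have "\<forall>\<^sub>F n in sequentially. (let h = t / real n in
            1 / (Gamma (1 - \<alpha>) * h powr \<alpha>) * (\<Sum>k=0..n. weight \<alpha> n k * y (real (n - k) * h))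
            - (caputo \<alpha> y t
               + 1 / Gamma (1 - \<alpha>) * (2 powr \<alpha> - 1) * zeta_real \<alpha>
                   * nderiv 1 {0..T} y t * h powr (1 - \<alpha>)
               - (2 powr (\<alpha> - 1) - 1) / Gamma (1 - \<alpha>) * zeta_real (\<alpha> - 1)
                   * nderiv 2 {0..T} y t * h powr (2 - \<alpha>)
               + 1 / 24 * (deriv ^^ 2) (caputo \<alpha> y) t * h ^ 2
               + 1 / Gamma (1 - \<alpha>)
                   * (1 / 24 * (2 powr \<alpha> - 1) * zeta_real \<alpha>
                      + 1 / 2 * (2 powr (\<alpha> - 2) - 1) * zeta_real (\<alpha> - 2))
                   * nderiv 3 {0..T} y t * h powr (3 - \<alpha>))) = E n / G"
    using eventually_gt_at_top [of 0]
  proof eventually_elim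
    fix n :: nat assume n: "0 < n"
    define h where "h = t / real n"
    have h: "h > 0" "real n * h = t" using n t by (simp_all add: h_def)
    have "(\<Sum>k=0..n. weight \<alpha> n k * y (real (n - k) * h))
        = (\<Sum>k<n. (real k + 1/2) powr (- \<alpha>) * (y (real (n - k) * h) - y (real (n - Suc k) * h)))"
      by (rule sum_weight [OF n])
    also have "\<dots> = (\<Sum>k<n. h powr \<alpha> * (((real k + 1/2) * h) powr (- \<alpha>)
          * (v 0 (real (Suc k) * h) - v 0 (real k * h))))"
    proof (rule sum.cong)
      fix k assume "k \<in> {..<n}"
      \<comment> \<open>For k < n both natural subtractions are exact, so the sample points are t -
        k h and t - (k + 1) h.\<close>
      then have "real (n - k) * h = t - real k * h" "real (n - Suc k) * h = t - real (Suc k) * h"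
        using h(2) by (simp_all add: of_nat_diff algebra_simps)
      moreover have "h powr \<alpha> * ((real k + 1/2) * h) powr (- \<alpha>) = (real k + 1/2) powr (- \<alpha>)"
        using h(1) by (simp add: powr_mult powr_minus)
      ultimately show "(real k + 1/2) powr (- \<alpha>) * (y (real (n - k) * h) - y (real (n - Suc k) * h))
          = h powr \<alpha> * (((real k + 1/2) * h) powr (- \<alpha>) * (v 0 (real (Suc k) * h) - v 0 (real k * h)))"
        unfolding mult.assoc [symmetric] by (simp add: v_def del: of_nat_Suc)
    qed simp
    finally have S: "1 / (G * h powr \<alpha>) * (\<Sum>k=0..n. weight \<alpha> n k * y (real (n - k) * h))
        = (\<Sum>k<n. ((real k + 1/2) * h) powr (- \<alpha>) * (v 0 (real (Suc k) * h) - v 0 (real k * h))) / G"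
      using h(1) by (simp add: sum_distrib_left [symmetric] del: of_nat_Suc)
    have v: "v 1 0 = ?Y 1 t" "v 2 0 = - ?Y 2 t" "v 3 0 = ?Y 3 t"
      by (simp_all add: v_def)
    show "(let h = t / real n in
            1 / (Gamma (1 - \<alpha>) * h powr \<alpha>) * (\<Sum>k=0..n. weight \<alpha> n k * y (real (n - k) * h))
            - (caputo \<alpha> y t
               + 1 / Gamma (1 - \<alpha>) * (2 powr \<alpha> - 1) * zeta_real \<alpha>
                   * nderiv 1 {0..T} y t * h powr (1 - \<alpha>)
               - (2 powr (\<alpha> - 1) - 1) / Gamma (1 - \<alpha>) * zeta_real (\<alpha> - 1)
                   * nderiv 2 {0..T} y t * h powr (2 - \<alpha>)
               + 1 / 24 * (deriv ^^ 2) (caputo \<alpha> y) t * h ^ 2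
               + 1 / Gamma (1 - \<alpha>)
                   * (1 / 24 * (2 powr \<alpha> - 1) * zeta_real \<alpha>
                      + 1 / 2 * (2 powr (\<alpha> - 2) - 1) * zeta_real (\<alpha> - 2))
                   * nderiv 3 {0..T} y t * h powr (3 - \<alpha>))) = E n / G"
      unfolding Let_def h_def [symmetric] G_def [symmetric] S E_def v
      using G by (simp add: diff_divide_distrib add_divide_distrib algebra_simps del: of_nat_Suc)
  qed
  ultimately show ?thesis
    by (subst landau_o.big.in_cong)
qed

end
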